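(* Let $G$ be a countable abelian group, let $X$ be a compact metric space, and let $G\curvearrowright X$ be a continuous action. If $G\curvearrowright X$ is Banach-mean equicontinuous, then $h_{\mathrm{top}}(X,G)=0$.
   Context: $G$ is a discrete group acting on the compact metric space $(X,d)$ by homeomorphisms. Let $\mathrm{Fin}(G)$ be the family of nonempty finite subsets of $G$. For $x,y\in X$ put $$\overline{D}(x,y)=\inf_{F\in \mathrm{Fin}(G)}\ \sup_{g\in G}\ \frac{1}{|F|}\sum_{t\in Fg}d(tx,ty).$$ The action is Banach-mean equicontinuous if for every $\varepsilon>0$ there is $\delta>0$ such that $\overline{D}(x,y)<\varepsilon$ whenever $x,y\in X$ and $d(x,y)<\delta$. $h_{\mathrm{top}}(X,G)$ is the usual topological entropy of an action of an amenable group (every abelian group is amenable): $h_{\mathrm{top}}(X,G)=\sup_{\mathcal U}\lim_{n\to\infty}\frac{1}{|F_n|}\log N\big(\bigvee_{s\in F_n}s^{-1}\mathcal U\big)$, where $\mathcal U$ ranges over finite open covers of $X$, $N(\cdot)$ is the minimal cardinality of a subcover, and $\{F_n\}$ is any (left) Følner sequence of $G$, i.e. a sequence of nonempty finite subsets with $|gF_n\triangle F_n|/|F_n|\to0$ for all $g\in G$.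
   Formalization: The formal theorem assumes that G is infinite; for finite G the claim fails (trivial group acting on two points: Banach-mean equicontinuous, but entropy log 2), and holds only when X has at most one point. *)

theory Defs
  imports "HOL-Analysis.Analysis" "HOL-Algebra.Coset" "HOL-Algebra.Group_Action"
begin

(* Throughout, the phase space is a subset X of a type of class metric_space and the action is a
   homomorphism \<phi> from G to BijGroup X, as in the locale group_action, so t x is \<phi> t x. *)

definition Fin :: "('g, 'b) monoid_scheme \<Rightarrow> 'g set set" where
  "Fin G = {F. F \<subseteq> carrier G \<and> finite F \<and> F \<noteq> {}}"

(* For x, y in a compact X all the averages lie in [0, diameter X], so the conditionally complete
   operators INF and SUP on the reals are the genuine infimum and supremum. *)
definition Dbar ::
    "('g, 'b) monoid_scheme \<Rightarrow> ('g \<Rightarrow> 'x::metric_space \<Rightarrow> 'x) \<Rightarrow> 'x \<Rightarrow> 'x \<Rightarrow> real" where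
  "Dbar G \<phi> x y =
     (INF F \<in> Fin G. SUP g \<in> carrier G.
        (1 / real (card F)) * (\<Sum>t \<in> F #>\<^bsub>G\<^esub> g. dist (\<phi> t x) (\<phi> t y)))"

definition Banach_mean_equicontinuous ::
    "('g, 'b) monoid_scheme \<Rightarrow> 'x::metric_space set \<Rightarrow> ('g \<Rightarrow> 'x \<Rightarrow> 'x) \<Rightarrow> bool" where
  "Banach_mean_equicontinuous G X \<phi> \<longleftrightarrow>
     (\<forall>\<epsilon>>0. \<exists>\<delta>>0. \<forall>x\<in>X. \<forall>y\<in>X. dist x y < \<delta> \<longrightarrow> Dbar G \<phi> x y < \<epsilon>)"

definition Folner_sequence :: "('g, 'b) monoid_scheme \<Rightarrow> (nat \<Rightarrow> 'g set) \<Rightarrow> bool" where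
  "Folner_sequence G F \<longleftrightarrow>
     (\<forall>n. F n \<in> Fin G) \<and>
     (\<forall>g\<in>carrier G.
        (\<lambda>n. real (card (sym_diff (g <#\<^bsub>G\<^esub> F n) (F n))) / real (card (F n))) \<longlonglongrightarrow> 0)"

definition finite_open_covers :: "'x::topological_space set \<Rightarrow> 'x set set set" where
  "finite_open_covers X =
     {\<U>. finite \<U> \<and> (\<forall>A\<in>\<U>. openin (top_of_set X) A) \<and> \<Union>\<U> = X}"

definition cover_number :: "'x set \<Rightarrow> 'x set set \<Rightarrow> nat" where
  "cover_number X \<U> = (LEAST n. \<exists>\<V>\<subseteq>\<U>. finite \<V> \<and> \<Union>\<V> = X \<and> card \<V> = n)"

(* The cover s^{-1} \<U>. *)
definition translate_cover ::
    "('g, 'b) monoid_scheme \<Rightarrow> ('g \<Rightarrow> 'x \<Rightarrow> 'x) \<Rightarrow> 'g \<Rightarrow> 'x set set \<Rightarrow> 'x set set" where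
  "translate_cover G \<phi> s \<U> = {\<phi> (inv\<^bsub>G\<^esub> s) ` A | A. A \<in> \<U>}"

(* The join over s in F (a nonempty index set) of the covers \<W> s: a member is obtained by choosing
   a set c s in each \<W> s and intersecting the chosen sets. *)
definition cover_join :: "'g set \<Rightarrow> ('g \<Rightarrow> 'x set set) \<Rightarrow> 'x set set" where
  "cover_join F \<W> = {(\<Inter>s\<in>F. c s) | c. c \<in> (\<Pi>\<^sub>E s\<in>F. \<W> s)}"

definition cover_entropy ::
    "('g, 'b) monoid_scheme \<Rightarrow> 'x set \<Rightarrow> ('g \<Rightarrow> 'x \<Rightarrow> 'x) \<Rightarrow> (nat \<Rightarrow> 'g set) \<Rightarrow> 'x set set \<Rightarrow> real" where
  "cover_entropy G X \<phi> F \<U> =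
     lim (\<lambda>n. (1 / real (card (F n))) *
              ln (real (cover_number X (cover_join (F n) (\<lambda>s. translate_cover G \<phi> s \<U>)))))"

(* The entropy computed along the Folner sequence F; each cover has finite entropy (at most
   ln (card \<U>)), but the supremum over covers may be infinite.  In the degenerate case X = {}
   the library convention ln 0 = 0 gives entropy 0. *)
definition top_entropy ::
    "('g, 'b) monoid_scheme \<Rightarrow> 'x::topological_space set \<Rightarrow> ('g \<Rightarrow> 'x \<Rightarrow> 'x) \<Rightarrow> (nat \<Rightarrow> 'g set) \<Rightarrow> ereal" where
  "top_entropy G X \<phi> F = (SUP \<U> \<in> finite_open_covers X. ereal (cover_entropy G X \<phi> F \<U>))"

end

theory Submission
  imports Defs "HOL-Library.Diagonal_Subsequence"
begin

text \<open>
  Suppose some cover has entropy at least \<open>h > 0\<close> along infinitely many Folner sets. These \<open>F n\<close>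
  carry finite sets \<open>E n\<close> of exponential size whose points are pairwise apart on a fixed proportion
  of \<open>F n\<close>. If for most \<open>g \<in> F n\<close> the points of \<open>E n\<close>, observed only on a window \<open>F j g\<close>, lay mostly
  close to at most \<open>m\<close> centres, then covering \<open>F n\<close> by about \<open>card (F n) / card (F j)\<close> such windows
  would encode half of \<open>E n\<close> by too few words as soon as \<open>F j\<close> is large. Hence, for all large \<open>j\<close>, a
  random translate of a random \<open>(m + 1)\<close>-tuple from \<open>E n\<close> is pairwise apart on \<open>F j\<close> with probability
  at least some \<open>c > 0\<close>, where \<open>c\<close> depends on \<open>m\<close> but the separation does not.

  A Poincare-type recurrence argument yields tuples that are pairwise apart on \<open>F j\<close> for one \<open>j\<close> from
  each of arbitrarily many prescribed finite blocks. When \<open>m\<close> balls of radius \<open>\<delta> / 4\<close> cover \<open>X\<close>, each tuple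
  contains a pair at distance less than \<open>\<delta> / 2\<close>, and compactness of \<open>X \<times> X\<close> produces a single pair at
  distance less than \<open>\<delta>\<close> that is apart on infinitely many \<open>F j\<close>, contradicting Banach-mean equicontinuity.
\<close>

section \<open>Counting\<close>

text \<open>Taking \<theta> small first and \<epsilon> small afterwards makes the exponent an
  arbitrarily small multiple of \<open>card T\<close>, so altering a word on a small proportion of
  its letters is negligible at exponential scale.\<close>

lemma hamming_ball_card:
  fixes \<theta> \<epsilon> :: real
  assumes T: "finite T" and U: "finite U" and th: "0 < \<theta>" "\<theta> < 1"
    and c0: "\<And>t. t \<in> T \<Longrightarrow> c0 t \<in> U"
  shows "real (card {C \<in> T \<rightarrow>\<^sub>E U. real (card {t\<in>T. C t \<noteq> c0 t}) \<le> \<epsilon> * card T})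
           \<le> exp (card T * (\<epsilon> * ln (1 / \<theta>) + \<theta> * card U))"
proof -
  let ?H = "{C \<in> T \<rightarrow>\<^sub>E U. real (card {t\<in>T. C t \<noteq> c0 t}) \<le> \<epsilon> * card T}"
  \<comment> \<open>Chernoff bound: every deviation from \<open>c0\<close> costs a factor \<open>\<theta>\<close>.\<close>
  define w where "w t a = (if a = c0 t then 1 else \<theta>)" for t a
  have fin: "finite (T \<rightarrow>\<^sub>E U)" using T U by (intro finite_PiE) auto
  have w0: "w t a \<ge> 0" for t a using th by (auto simp: w_def)
  have low: "\<theta> powr (\<epsilon> * card T) \<le> (\<Prod>t\<in>T. w t (C t))" if "C \<in> ?H" for C
  proof -
    have "(\<Prod>t\<in>T. w t (C t)) = (\<Prod>t\<in>{t\<in>T. C t \<noteq> c0 t}. \<theta>)"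
      using T by (intro prod.mono_neutral_cong_right) (auto simp: w_def)
    also have "\<dots> = \<theta> powr (card {t\<in>T. C t \<noteq> c0 t})"
      using th by (simp add: powr_realpow)
    finally show ?thesis using that th by (simp add: powr_mono')
  qed
  have "card ?H * \<theta> powr (\<epsilon> * card T) \<le> (\<Sum>C\<in>?H. \<Prod>t\<in>T. w t (C t))"
    using sum_mono[of ?H "\<lambda>_. \<theta> powr (\<epsilon> * card T)", OF low] by simp
  also have "\<dots> \<le> (\<Sum>C\<in>T \<rightarrow>\<^sub>E U. \<Prod>t\<in>T. w t (C t))"
    using fin w0 by (intro sum_mono2) (auto intro!: prod_nonneg)
  also have "\<dots> = (\<Prod>t\<in>T. \<Sum>a\<in>U. w t a)"
    using T U by (simp add: prod_sum_PiE)
  also have "\<dots> \<le> (\<Prod>t\<in>T. exp (\<theta> * card U))"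
  proof (intro prod_mono conjI)
    fix t assume t: "t \<in> T"
    show "0 \<le> sum (w t) U" using w0 by (simp add: sum_nonneg)
    have "sum (w t) U = w t (c0 t) + sum (w t) (U - {c0 t})"
      using U c0[OF t] by (simp add: sum.remove)
    also have "sum (w t) (U - {c0 t}) = sum (\<lambda>_. \<theta>) (U - {c0 t})"
      by (intro sum.cong) (auto simp: w_def)
    also have "\<dots> \<le> \<theta> * card U"
      using U th card_mono[of U "U - {c0 t}"] by (simp add: mult.commute)
    finally have "sum (w t) U \<le> 1 + \<theta> * card U" by (simp add: w_def)
    then show "sum (w t) U \<le> exp (\<theta> * card U)"
      using exp_ge_add_one_self[of "\<theta> * card U"] by linarith
  qed
  also have "\<dots> = exp (card T * (\<theta> * card U))" by (simp add: exp_of_nat_mult)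
  finally have "card ?H * \<theta> powr (\<epsilon> * card T) \<le> exp (card T * (\<theta> * card U))" .
  then have "card ?H \<le> exp (card T * (\<theta> * card U)) / \<theta> powr (\<epsilon> * card T)"
    using th by (simp add: field_simps)
  also have "\<dots> = exp (card T * (\<epsilon> * ln (1 / \<theta>) + \<theta> * card U))"
    using th by (simp add: powr_def exp_diff[symmetric] ln_div algebra_simps)
  finally show ?thesis .
qed

text \<open>Lists grow at the head: the at most \<open>m\<close> entries already present leave at
  least \<open>b\<close> choices for the next one, and \<open>sorted_wrt\<close> asks only that the
  new head be related to all of them.\<close>

lemma card_separated_lists:
  fixes b :: real
  assumes E: "finite E" and b: "0 \<le> b"
    and spread: "\<And>Y. Y \<subseteq> E \<Longrightarrow> card Y \<le> m \<Longrightarrow> b \<le> card {x\<in>E. \<forall>y\<in>Y. R x y}"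
  shows "i \<le> Suc m \<Longrightarrow> b ^ i \<le> card {xs. set xs \<subseteq> E \<and> length xs = i \<and> sorted_wrt R xs}"
proof (induction i)
  case 0
  have "{xs. set xs \<subseteq> E \<and> length xs = 0 \<and> sorted_wrt R xs} = {[]}" by auto
  then show ?case by simp
next
  case (Suc i)
  define L where "L = {xs. set xs \<subseteq> E \<and> length xs = i \<and> sorted_wrt R xs}"
  have finL: "finite L"
    by (rule finite_subset[OF _ finite_lists_length_eq[OF E, of i]]) (auto simp: L_def)
  have "{xs. set xs \<subseteq> E \<and> length xs = Suc i \<and> sorted_wrt R xs}
      = (\<lambda>(xs, x). x # xs) ` (SIGMA xs:L. {x\<in>E. \<forall>y\<in>set xs. R x y})"
    by (auto simp: L_def length_Suc_conv image_iff)
  moreover have "inj_on (\<lambda>(xs, x). x # xs) (SIGMA xs:L. {x\<in>E. \<forall>y\<in>set xs. R x y})"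
    by (auto simp: inj_on_def)
  ultimately have "real (card {xs. set xs \<subseteq> E \<and> length xs = Suc i \<and> sorted_wrt R xs})
      = (\<Sum>xs\<in>L. real (card {x\<in>E. \<forall>y\<in>set xs. R x y}))"
    using finL E by (simp add: card_image card_SigmaI)
  also have "\<dots> \<ge> (\<Sum>xs\<in>L. b)"
    using Suc.prems by (intro sum_mono spread)
      (auto simp: L_def intro: order.trans[OF card_length])
  finally have *: "card L * b \<le> card {xs. set xs \<subseteq> E \<and> length xs = Suc i \<and> sorted_wrt R xs}"
    by simp
  have "b ^ Suc i \<le> card L * b"
    using Suc b by (simp add: L_def mult.commute mult_left_mono)
  with * show ?case by linarith
qed

section \<open>Covering by windows and coding of points\<close>

text \<open>Averaging over a uniformly chosen \<open>g\<close>: a point of \<open>U\<close> is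
  missed with probability at most \<open>1 - q / card A\<close>, and the mean cost is at most
  \<open>B / card A\<close>. Both quantities are bounded in one sum so that a single list serves for
  both.\<close>

lemma ex_list_cover:
  fixes b :: "'g \<Rightarrow> real" and W :: "'g \<Rightarrow> 'a set"
  assumes A: "finite A" "A \<noteq> {}" and q: "q \<le> card A"
    and sumb: "(\<Sum>g\<in>A. b g) \<le> B"
    and cover: "\<And>t. t \<in> U \<Longrightarrow> q \<le> card {g\<in>A. t \<in> W g}" and U: "finite U"
  shows "\<exists>gs. set gs \<subseteq> A \<and> length gs = r \<and>
      card (U - (\<Union>g\<in>set gs. W g)) + (\<Sum>g\<leftarrow>gs. b g)
        \<le> card U * (1 - q / card A) ^ r + r * (B / card A)"
  using cover U
proof (induction r arbitrary: U)
  case 0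
  show ?case by (intro exI[of _ "[]"]) simp
next
  case (Suc r)
  define a where "a = 1 - q / card A"
  have cA: "card A > 0" using A by (simp add: card_gt_0_iff)
  have a0: "a \<ge> 0" using q cA by (simp add: a_def field_simps)
  have "(\<Sum>g\<in>A. real (card (U - W g))) = (\<Sum>g\<in>A. \<Sum>t\<in>U. if t \<in> W g then 0 else 1)"
    using Suc.prems(2) by (intro sum.cong refl) (simp add: sum.If_cases set_diff_eq Collect_conj_eq Compl_eq)
  also have "\<dots> = (\<Sum>t\<in>U. real (card A) - card {g\<in>A. t \<in> W g})"
  proof (subst sum.swap, intro sum.cong refl)
    fix t
    have "(\<Sum>g\<in>A. if t \<in> W g then 0 else 1) = (\<Sum>g\<in>A. 1 - (if t \<in> W g then 1 else 0::real))"
      by (intro sum.cong) auto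
    also have "\<dots> = real (card A) - card {g\<in>A. t \<in> W g}"
      using A by (simp add: sum_subtractf sum.If_cases Collect_conj_eq)
    finally show "(\<Sum>g\<in>A. if t \<in> W g then 0 else 1) = real (card A) - card {g\<in>A. t \<in> W g}" .
  qed
  also have "\<dots> \<le> (\<Sum>t\<in>U. real (card A) - q)"
    using Suc.prems by (intro sum_mono) auto
  also have "\<dots> = card U * (card A * a)"
    using cA by (simp add: a_def field_simps)
  finally have s: "(\<Sum>g\<in>A. real (card (U - W g))) \<le> card U * (card A * a)" .
  \<comment> \<open>The weight \<open>a ^ r\<close> discounts each uncovered point by the effect of
    the remaining \<open>r\<close> choices, so the averaged potential fits the induction hypothesis
    for \<open>U - W g\<close>.\<close>
  have "(\<Sum>g\<in>A. card (U - W g) * a ^ r + b g) \<le> card U * (card A * a) * a ^ r + B"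
    unfolding sum.distrib sum_distrib_right[symmetric]
    using s a0 sumb by (intro add_mono mult_right_mono) auto
  also have "\<dots> = (\<Sum>g\<in>A. card U * a ^ Suc r + B / card A)"
    using cA by (simp add: field_simps)
  finally have "\<exists>g\<in>A. card (U - W g) * a ^ r + b g \<le> card U * a ^ Suc r + B / card A"
    using A sum_strict_mono[of A "\<lambda>g. card U * a ^ Suc r + B / card A"
        "\<lambda>g. card (U - W g) * a ^ r + b g"]
    by (meson not_le)
  then obtain g where g: "g \<in> A" "card (U - W g) * a ^ r + b g \<le> card U * a ^ Suc r + B / card A"
    by blast
  have "\<exists>gs. set gs \<subseteq> A \<and> length gs = r \<and>
      card ((U - W g) - (\<Union>g\<in>set gs. W g)) + (\<Sum>g\<leftarrow>gs. b g)
        \<le> card (U - W g) * (1 - q / card A) ^ r + r * (B / card A)"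
    by (rule Suc.IH) (use Suc.prems in auto)
  then obtain gs where gs: "set gs \<subseteq> A" "length gs = r"
      "card ((U - W g) - (\<Union>g\<in>set gs. W g)) + (\<Sum>g\<leftarrow>gs. b g)
        \<le> card (U - W g) * a ^ r + r * (B / card A)"
    unfolding a_def by blast
  have eq: "U - (\<Union>g\<in>set (g # gs). W g) = (U - W g) - (\<Union>g\<in>set gs. W g)" by auto
  show ?case
    unfolding a_def[symmetric]
    by (intro exI[of _ "g # gs"] conjI, use g gs in simp, use gs in simp, subst eq)
      (use g gs in \<open>simp add: algebra_simps add_divide_distrib\<close>)
qed

lemma card_UN_list_le: "real (card (\<Union>g\<in>set gs. V g)) \<le> (\<Sum>g\<leftarrow>gs. real (card (V g)))"
proof (induction gs)
  case (Cons g gs)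
  then show ?case using card_Un_le[of "V g" "\<Union>g\<in>set gs. V g"] by simp
qed simp

lemma sum_sum_list_swap: "(\<Sum>x\<in>E. \<Sum>g\<leftarrow>gs. f g x) = (\<Sum>g\<leftarrow>gs. \<Sum>x\<in>E. f g x :: real)"
  by (induction gs) (auto simp: sum.distrib)

text \<open>A coding argument. About \<open>K * card A / q\<close> windows cover most of
  \<open>A\<close>; a point is encoded by the centre it is near in each window, with one extra
  letter for being near none. On at least half of \<open>E\<close> the code is injective, since
  points with the same code would differ on at most a proportion \<epsilon> of
  \<open>A\<close>.\<close>

lemma card_le_if_windows_concentrated:
  fixes \<epsilon> \<eta> \<beta> \<kappa> K :: real and D :: "'x \<Rightarrow> 'x \<Rightarrow> 'g set"
  assumes A: "finite A" "A \<noteq> {}" and E: "finite E"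
    and q: "0 < q" "q \<le> card A"
    and U: "U \<subseteq> A" "card (A - U) \<le> \<eta> * card A"
    and cover: "\<And>t. t \<in> U \<Longrightarrow> q \<le> card {g\<in>A. t \<in> W g}"
    and cardW: "\<And>g. g \<in> A \<Longrightarrow> finite (W g)" "\<And>g. g \<in> A \<Longrightarrow> card (W g) \<le> q"
    and near: "\<And>g x x' y. g \<in> A \<Longrightarrow> x \<in> E \<Longrightarrow> x' \<in> E \<Longrightarrow> y \<in> E \<Longrightarrow> near g x y \<Longrightarrow> near g x' y
      \<Longrightarrow> card (W g \<inter> D x x') \<le> 2 * \<kappa> * q"
    and D: "\<And>x x'. D x x' \<subseteq> A"
    and sep: "\<And>x x'. x \<in> E \<Longrightarrow> x' \<in> E \<Longrightarrow> x \<noteq> x' \<Longrightarrow> \<epsilon> * card A < card (D x x')"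
    and conc: "card {g\<in>A. \<not> (\<exists>Y\<subseteq>E. card Y \<le> m \<and>
                   card {x\<in>E. \<forall>y\<in>Y. \<not> near g x y} \<le> \<beta> * card E)} \<le> \<beta> * card A"
    and pos: "0 < K" "0 \<le> \<beta>" "0 \<le> \<kappa>"
    and const: "\<eta> + 3 * exp (- K) + 6 * \<beta> * (K + 1) + 2 * \<kappa> * (K + 1) \<le> \<epsilon>"
  shows "card E \<le> 2 * (m + 1) ^ nat \<lceil>K * card A / q\<rceil>"
proof (cases "E = {}")
  case True
  then show ?thesis by simp
next
  case False
  \<comment> \<open>So many windows that \<open>r * q\<close> is at least \<open>K * card A\<close>;
    rounding up adds at most \<open>q\<close>, hence at most \<open>card A\<close>.\<close>
  define r where "r = nat \<lceil>K * card A / q\<rceil>"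
  define C where "C g \<longleftrightarrow> (\<exists>Y\<subseteq>E. card Y \<le> m \<and> card {x\<in>E. \<forall>y\<in>Y. \<not> near g x y} \<le> \<beta> * card E)" for g
  have cA: "card A > 0" and cE: "card E > 0" using A E False by (simp_all add: card_gt_0_iff)
  have r_ge: "K * card A \<le> r * q"
  proof -
    have "K * card A / q \<le> r" unfolding r_def by linarith
    then show ?thesis using q by (simp add: field_simps)
  qed
  have r_le: "r * q \<le> (K + 1) * card A"
  proof -
    have "K * card A / q \<ge> 0" using pos by simp
    then have "r \<le> K * card A / q + 1" unfolding r_def by linarith
    then have "r * q \<le> K * card A + q" using q by (simp add: field_simps)
    then show ?thesis using q by (simp add: algebra_simps)
  qed
  have pw: "(1 - q / card A) ^ r \<le> exp (- K)"
  proof -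
    have "(1 - q / card A) ^ r \<le> exp (- (q / card A)) ^ r"
      using q cA exp_ge_add_one_self[of "- (q / card A)"]
      by (intro power_mono) (auto simp: field_simps)
    also have "\<dots> = exp (- (r * q / card A))" by (simp add: exp_of_nat_mult[symmetric])
    also have "\<dots> \<le> exp (- K)" using r_ge cA by (simp add: field_simps)
    finally show ?thesis .
  qed
  \<comment> \<open>Centres are chosen for every \<open>g\<close>; where concentration fails nothing
    is demanded of them beyond their number, and the empty set is a witness.\<close>
  have "\<exists>Y. Y \<subseteq> E \<and> card Y \<le> m \<and> (C g \<longrightarrow> card {x\<in>E. \<forall>y\<in>Y. \<not> near g x y} \<le> \<beta> * card E)" for g
  proof (cases "C g")
    case True
    then show ?thesis unfolding C_def by blast
  next
    case False
    then show ?thesis by (intro exI[of _ "{}"]) simp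
  qed
  then have "\<forall>g. \<exists>Y. Y \<subseteq> E \<and> card Y \<le> m \<and> (C g \<longrightarrow> card {x\<in>E. \<forall>y\<in>Y. \<not> near g x y} \<le> \<beta> * card E)"
    by blast
  from choice[OF this] obtain Y where Y: "\<And>g. Y g \<subseteq> E \<and> card (Y g) \<le> m \<and>
      (C g \<longrightarrow> card {x\<in>E. \<forall>y\<in>Y g. \<not> near g x y} \<le> \<beta> * card E)"
    by blast
  have YE: "Y g \<subseteq> E" "card (Y g) \<le> m" for g using Y[of g] by simp_all
  have "\<exists>f. inj_on f (Y g) \<and> f ` Y g \<subseteq> {..<m}" for g
  proof -
    have "finite (Y g)" using YE E finite_subset by blast
    then show ?thesis using card_le_inj[of "Y g" "{..<m}"] YE(2)[of g] by auto
  qed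
  then have "\<forall>g. \<exists>f. inj_on f (Y g) \<and> f ` Y g \<subseteq> {..<m}" by blast
  from choice[OF this] obtain f where f: "\<And>g. inj_on (f g) (Y g)" "\<And>g. f g ` Y g \<subseteq> {..<m}" by blast
  define bad where "bad g x \<longleftrightarrow> (\<forall>y\<in>Y g. \<not> near g x y)" for g x
  define ctr where "ctr g x = (SOME y. y \<in> Y g \<and> near g x y)" for g x
  \<comment> \<open>Letter 0 marks a point near no centre; \<open>Suc\<close> keeps it apart from
    the numbered centres, so the alphabet is \<open>{..m}\<close>.\<close>
  define code where "code g x = (if bad g x then 0 else Suc (f g (ctr g x)))" for g x
  have ctr: "ctr g x \<in> Y g" "near g x (ctr g x)" if "\<not> bad g x" for g x
    using someI_ex[of "\<lambda>y. y \<in> Y g \<and> near g x y"] that unfolding ctr_def bad_def by blast+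
  have code_le: "code g x \<le> m" for g x
    using ctr(1)[of g x] f(2)[of g] by (force simp: code_def Suc_le_eq)
  have same: "bad g x = bad g x' \<and> (\<not> bad g x \<longrightarrow> ctr g x = ctr g x')" if "code g x = code g x'" for g x x'
    using that ctr(1)[of g x] ctr(1)[of g x'] f(1)[of g]
    by (auto simp: code_def inj_on_def split: if_splits)
  define nbad where "nbad g = card {x\<in>E. bad g x}" for g
  \<comment> \<open>Covering loss plus cost of bad points, as proportions of \<open>card A\<close>:
    the mean bad proportion is at most 2\<beta>, over windows of total size at most
    \<open>(K + 1) * card A\<close>.\<close>
  define \<tau> where "\<tau> = exp (- K) + 2 * \<beta> * (K + 1)"
  have \<tau>: "\<tau> > 0" using pos by (simp add: \<tau>_def add_pos_nonneg)
  \<comment> \<open>A concentrated \<open>g\<close> contributes at most a proportion \<beta> of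
    \<open>E\<close>; the others may contribute all of \<open>E\<close> but form at most a
    proportion \<beta> of \<open>A\<close>.\<close>
  have "(\<Sum>g\<in>A. real (nbad g)) \<le> (\<Sum>g\<in>A. \<beta> * card E + (if C g then 0 else real (card E)))"
  proof (rule sum_mono)
    fix g
    have "nbad g \<le> card E" unfolding nbad_def using E by (intro card_mono) auto
    then show "nbad g \<le> \<beta> * card E + (if C g then 0 else real (card E))"
      using Y[of g] pos by (auto simp: nbad_def bad_def add_increasing)
  qed
  also have "\<dots> = \<beta> * card E * card A + real (card E) * card {g\<in>A. \<not> C g}"
    using A by (simp add: sum.distrib sum.If_cases Collect_conj_eq Compl_eq)
  also have "\<dots> \<le> \<beta> * card E * card A + card E * (\<beta> * card A)"
    using conc[folded C_def] by (intro add_left_mono mult_left_mono) simp_all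
  finally have sum_bad: "(\<Sum>g\<in>A. real (nbad g)) \<le> 2 * \<beta> * card A * card E"
    by (simp add: algebra_simps)
  \<comment> \<open>The cost \<open>nbad g * (q / card E)\<close> is the mean over \<open>x\<close>
    in \<open>E\<close> of the loss of \<open>q\<close> suffered when \<open>x\<close> is bad at
    \<open>g\<close>.\<close>
  have "(\<Sum>g\<in>A. nbad g * (q / card E)) \<le> 2 * \<beta> * card A * q"
    unfolding sum_distrib_right[symmetric] using sum_bad cE q by (simp add: field_simps)
  from ex_list_cover[of A q _ _ U W r, OF A q(2) this cover] U A
  obtain gs where gs: "set gs \<subseteq> A" "length gs = r"
      "card (U - (\<Union>g\<in>set gs. W g)) + (\<Sum>g\<leftarrow>gs. nbad g * (q / card E))
        \<le> card U * (1 - q / card A) ^ r + r * (2 * \<beta> * card A * q / card A)"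
    using finite_subset by blast
  have "card U * (1 - q / card A) ^ r \<le> card A * exp (- K)"
    using pw U A q cA by (intro mult_mono) (auto intro!: card_mono zero_le_power simp: field_simps)
  moreover have "r * (2 * \<beta> * card A * q / card A) \<le> 2 * \<beta> * ((K + 1) * card A)"
    using r_le cA pos by (simp add: mult_left_mono mult.left_commute[of "real r"])
  ultimately have gs3: "card (U - (\<Union>g\<in>set gs. W g)) + (\<Sum>g\<leftarrow>gs. nbad g * (q / card E)) \<le> \<tau> * card A"
    using gs(3) by (simp add: \<tau>_def algebra_simps)
  define nb where "nb x = (\<Sum>g\<leftarrow>gs. if bad g x then 1 else 0::real)" for x
  have nb0: "nb x \<ge> 0" for x unfolding nb_def by (rule sum_list_nonneg) auto
  have "(\<Sum>x\<in>E. nb x) = (\<Sum>g\<leftarrow>gs. real (nbad g))"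
    unfolding nb_def sum_sum_list_swap nbad_def using E
    by (simp add: sum.If_cases Collect_conj_eq)
  also have "\<dots> = (\<Sum>g\<leftarrow>gs. nbad g * (q / card E)) * (card E / q)"
    unfolding sum_list_mult_const using q cE by simp
  also have "\<dots> \<le> \<tau> * card A * (card E / q)"
    using gs3 by (intro mult_right_mono) auto
  finally have sum_nb: "(\<Sum>x\<in>E. nb x) \<le> \<tau> * card A * (card E / q)" .
  \<comment> \<open>Markov's inequality: \<open>nb x * q\<close> has mean at most
    \<open>\<tau> * card A\<close> over \<open>E\<close>, so at least half of the points stay below
    twice that.\<close>
  define E' where "E' = {x\<in>E. nb x * q \<le> 2 * \<tau> * card A}"
  have "card (E - E') * (2 * \<tau> * card A / q) \<le> (\<Sum>x\<in>E - E'. nb x)"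
    using q by (intro sum_bounded_below[where K = "2 * \<tau> * card A / q", of "E - E'" nb])
      (auto simp: E'_def field_simps)
  also have "\<dots> \<le> (\<Sum>x\<in>E. nb x)" using E nb0 by (intro sum_mono2) auto
  also note sum_nb
  finally have "card (E - E') * 2 \<le> real (card E)"
    using \<tau> cA q by (simp add: field_simps)
  moreover have "card (E - E') = card E - card E'" "card E' \<le> card E"
    using E by (auto simp: E'_def intro!: card_Diff_subset card_mono)
  ultimately have E'_large: "card E \<le> 2 * card E'" by (simp add: of_nat_diff)
  have "inj_on (\<lambda>x. map (\<lambda>g. code g x) gs) E'"
  proof (rule inj_onI, rule ccontr)
    fix x x' assume x: "x \<in> E'" "x' \<in> E'" "map (\<lambda>g. code g x) gs = map (\<lambda>g. code g x') gs" and ne: "x \<noteq> x'"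
    have finU: "finite (A - U)" "finite (U - (\<Union>g\<in>set gs. W g))" "finite (\<Union>g\<in>set gs. W g \<inter> D x x')"
      using A U(1) finite_subset[OF U(1)] finite_subset[OF D] by auto
    \<comment> \<open>The points of \<open>D x x'\<close> lie outside \<open>U\<close> (\<eta>), or
      are uncovered (\<tau>), or lie in windows bad for \<open>x\<close> (at most 2\<tau>) or in
      windows with a common centre (2\<kappa> of each). The total is at most \<epsilon>, against
      \<open>sep\<close>.\<close>
    have "D x x' \<subseteq> (A - U) \<union> ((U - (\<Union>g\<in>set gs. W g)) \<union> (\<Union>g\<in>set gs. W g \<inter> D x x'))"
      using D by auto
    then have "card (D x x') \<le> card (A - U) + (card (U - (\<Union>g\<in>set gs. W g)) + card (\<Union>g\<in>set gs. W g \<inter> D x x'))"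
      using finU by (meson card_mono card_Un_le order.trans add_left_mono finite_UnI)
    moreover have "card (\<Union>g\<in>set gs. W g \<inter> D x x') \<le> 2 * \<tau> * card A + 2 * \<kappa> * (K + 1) * card A"
    proof -
      have "real (card (\<Union>g\<in>set gs. W g \<inter> D x x')) \<le> (\<Sum>g\<leftarrow>gs. real (card (W g \<inter> D x x')))"
        by (rule card_UN_list_le)
      also have "\<dots> \<le> (\<Sum>g\<leftarrow>gs. (if bad g x then 1 else 0) * real q + 2 * \<kappa> * q)"
      proof (rule sum_list_mono)
        fix g assume g: "g \<in> set gs"
        then have gA: "g \<in> A" using gs by auto
        have sm: "bad g x = bad g x' \<and> (\<not> bad g x \<longrightarrow> ctr g x = ctr g x')"
          using x(3) g by (intro same) auto
        show "card (W g \<inter> D x x') \<le> (if bad g x then 1 else 0) * real q + 2 * \<kappa> * q"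
        proof (cases "bad g x")
          case True
          have "card (W g \<inter> D x x') \<le> card (W g)" using cardW gA by (intro card_mono) auto
          then show ?thesis using True cardW(2)[OF gA] pos by (simp add: add_increasing2)
        next
          case False
          then have "card (W g \<inter> D x x') \<le> 2 * \<kappa> * q"
            using ctr[of g x] ctr[of g x'] sm YE(1)[of g] x
            by (intro near[OF gA, of _ _ "ctr g x"]) (auto simp: E'_def)
          then show ?thesis using False by simp
        qed
      qed
      also have "\<dots> = nb x * q + 2 * \<kappa> * (r * q)"
        unfolding nb_def sum_list_addf sum_list_mult_const gs(2)[symmetric]
        by (simp add: sum_list_triv)
      also have "\<dots> \<le> 2 * \<tau> * card A + 2 * \<kappa> * ((K + 1) * card A)"
        using x r_le pos by (intro add_mono mult_left_mono) (auto simp: E'_def)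
      finally show ?thesis by (simp add: algebra_simps)
    qed
    moreover have "card (U - (\<Union>g\<in>set gs. W g)) \<le> \<tau> * card A"
    proof -
      have "0 \<le> (\<Sum>g\<leftarrow>gs. nbad g * (q / card E))" by (rule sum_list_nonneg) auto
      with gs3 show ?thesis by linarith
    qed
    ultimately have "card (D x x') \<le> (\<eta> + 3 * \<tau> + 2 * \<kappa> * (K + 1)) * card A"
      using U(2) by (simp add: algebra_simps)
    also have "\<dots> \<le> \<epsilon> * card A"
      using const by (intro mult_right_mono) (auto simp: \<tau>_def algebra_simps)
    finally show False using sep[of x x'] x ne by (auto simp: E'_def)
  qed
  moreover have "(\<lambda>x. map (\<lambda>g. code g x) gs) ` E' \<subseteq> {xs. set xs \<subseteq> {..m} \<and> length xs = r}"
    using code_le gs(2) by auto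
  ultimately have "card E' \<le> card {xs. set xs \<subseteq> {..m} \<and> length xs = r}"
    by (intro card_inj_on_le) (auto intro: finite_lists_length_eq)
  also have "\<dots> = (m + 1) ^ r" by (subst card_lists_length_eq) auto
  finally show ?thesis using E'_large by (simp add: r_def)
qed

section \<open>Recurrence\<close>

lemma countable_family_convergent_subseq:
  fixes p :: "'i::countable \<Rightarrow> nat \<Rightarrow> real"
  assumes bnd: "\<And>i n. 0 \<le> p i n" "\<And>i n. p i n \<le> 1"
  shows "\<exists>\<rho>. strict_mono \<rho> \<and> (\<forall>i. convergent (\<lambda>n. p i (\<rho> n)))"
proof -
  \<comment> \<open>Vacuous at numbers that code no index, so the diagonal argument over the
    naturals applies to any countable index type.\<close>
  define P where "P k s \<longleftrightarrow> (\<forall>i::'i. to_nat i = k \<longrightarrow> convergent (p i \<circ> s))" for k and s :: "nat \<Rightarrow> nat"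
  interpret subseqs P
  proof
    fix k and s :: "nat \<Rightarrow> nat"
    have ex: "\<exists>r. strict_mono r \<and> convergent (p i \<circ> (s \<circ> r))" for i
    proof -
      have "\<forall>n. (p i \<circ> s) n \<in> {0..1}" using bnd by simp
      then obtain l r where "strict_mono r" "((p i \<circ> s) \<circ> r) \<longlonglongrightarrow> l"
        using compact_imp_seq_compact[OF compact_Icc[of 0 "1::real"]] unfolding seq_compact_def by metis
      then show ?thesis by (auto simp: convergent_def o_assoc)
    qed
    show "\<exists>r'. strict_mono r' \<and> P k (s \<circ> r')"
    proof (cases "\<exists>i::'i. to_nat i = k")
      case True
      then obtain i :: 'i where "to_nat i = k" by blast
      moreover obtain r where "strict_mono r" "convergent (p i \<circ> (s \<circ> r))" using ex by blast
      ultimately show ?thesis by (metis P_def to_nat_split inj_eq inj_to_nat)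
    next
      case False
      then show ?thesis using strict_mono_id by (auto simp: P_def)
    qed
  qed
  have "convergent (\<lambda>n. p i (diagseq n))" for i
  proof -
    \<comment> \<open>Only a tail of the diagonal sequence is known to be a subsequence of the one
      chosen at stage \<open>to_nat i\<close>; the shift is removed afterwards.\<close>
    have "P (to_nat i) (diagseq \<circ> ((+) (Suc (to_nat i))))"
    proof (rule diagseq_holds)
      fix r s :: "nat \<Rightarrow> nat" and n assume "strict_mono r" "P n s"
      then show "P n (s \<circ> r)"
        unfolding P_def o_assoc by (metis convergent_subseq_convergent)
    qed
    then have "convergent (p i \<circ> (diagseq \<circ> ((+) (Suc (to_nat i)))))" by (simp add: P_def)
    then have "convergent (\<lambda>n. p i (diagseq (n + Suc (to_nat i))))"
      by (simp add: o_def add.commute)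
    then show ?thesis by (rule iffD1[OF convergent_ignore_initial_segment])
  qed
  then show ?thesis using subseq_diagseq by blast
qed

section \<open>Frequencies of events in finite sample spaces\<close>

text \<open>The uniform probability measure on \<open>\<Omega>\<close>, and 0 when
  \<open>\<Omega>\<close> is empty. Intersecting with \<open>\<Omega>\<close> lets the same event be
  measured in varying sample spaces.\<close>

definition freq :: "'a set \<Rightarrow> 'a set \<Rightarrow> real" where
  "freq \<Omega> B = card (\<Omega> \<inter> B) / card \<Omega>"

lemma freq_bounds: "finite \<Omega> \<Longrightarrow> 0 \<le> freq \<Omega> B" "finite \<Omega> \<Longrightarrow> freq \<Omega> B \<le> 1"
  by (auto simp: freq_def divide_le_eq card_mono card_gt_0_iff)

lemma freq_mono: "finite \<Omega> \<Longrightarrow> B \<subseteq> C \<Longrightarrow> freq \<Omega> B \<le> freq \<Omega> C"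
  unfolding freq_def by (intro divide_right_mono) (auto intro!: card_mono)

lemma freq_Diff: "finite \<Omega> \<Longrightarrow> B \<subseteq> C \<Longrightarrow> freq \<Omega> (C - B) = freq \<Omega> C - freq \<Omega> B"
proof -
  assume f: "finite \<Omega>" and s: "B \<subseteq> C"
  have "\<Omega> \<inter> (C - B) = (\<Omega> \<inter> C) - (\<Omega> \<inter> B)" by auto
  moreover have "card ((\<Omega> \<inter> C) - (\<Omega> \<inter> B)) = card (\<Omega> \<inter> C) - card (\<Omega> \<inter> B)"
    using f s by (intro card_Diff_subset) auto
  moreover have "card (\<Omega> \<inter> B) \<le> card (\<Omega> \<inter> C)"
    using f s by (intro card_mono) auto
  ultimately show ?thesis by (simp add: freq_def diff_divide_distrib)
qed

lemma freq_Un_le: "finite \<Omega> \<Longrightarrow> freq \<Omega> (B \<union> C) \<le> freq \<Omega> B + freq \<Omega> C"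
  unfolding freq_def add_divide_distrib[symmetric] of_nat_add[symmetric] Int_Un_distrib
  by (intro divide_right_mono of_nat_mono card_Un_le) auto

lemma freq_UN_le:
  assumes "finite \<Omega>" "finite I"
  shows "freq \<Omega> (\<Union>i\<in>I. B i) \<le> (\<Sum>i\<in>I. freq \<Omega> (B i))"
  using assms(2)
proof induction
  case empty
  show ?case by (simp add: freq_def)
next
  case (insert i I)
  then show ?case using freq_Un_le[OF assms(1), of "B i" "\<Union>i\<in>I. B i"] by simp
qed

text \<open>
  As in the proof of the reverse Fatou lemma: along a subsequence the frequencies of all finite unions
  converge, and each block is taken so long that extending it further gains almost nothing. No single
  index per block is selected, because finite unions of closed conditions stay closed in the application.
\<close>

lemma recurrent_blocks:
  fixes \<Omega> :: "nat \<Rightarrow> 'a set" and A :: "nat \<Rightarrow> 'a set"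
  assumes fin: "\<And>n. finite (\<Omega> n)" and c: "0 < c"
    and ev: "\<And>j. \<forall>\<^sub>F n in sequentially. c \<le> freq (\<Omega> n) (A j)"
  shows "\<exists>k. strict_mono k \<and> (\<forall>I. (\<Inter>i\<le>I. \<Union>j\<in>{k i..<k (Suc i)}. A j) \<noteq> {})"
proof -
  define B where "B k l = (\<Union>j\<in>{k..<l}. A j)" for k l
  define p where "p = (\<lambda>(k, l) n. freq (\<Omega> n) (B k l))"
  obtain \<rho> where \<rho>: "strict_mono \<rho>" "\<And>i. convergent (\<lambda>n. p i (\<rho> n))"
    using countable_family_convergent_subseq[of p] fin by (auto simp: p_def freq_bounds)
  define b where "b k l = lim (\<lambda>n. p (k, l) (\<rho> n))" for k l
  have lim: "(\<lambda>n. freq (\<Omega> (\<rho> n)) (B k l)) \<longlonglongrightarrow> b k l" for k l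
    using \<rho>(2)[of "(k, l)"] by (simp add: b_def p_def convergent_LIMSEQ_iff)
  have b1: "b k l \<le> 1" for k l
    by (rule LIMSEQ_le_const2[OF lim]) (use fin freq_bounds in blast)
  have bc: "c \<le> b k l" if "k < l" for k l
  proof (rule tendsto_lowerbound[OF lim])
    have "\<forall>\<^sub>F n in sequentially. c \<le> freq (\<Omega> (\<rho> n)) (A k)"
      using ev[of k] filterlim_subseq[OF \<rho>(1)] by (rule eventually_compose_filterlim)
    then show "\<forall>\<^sub>F n in sequentially. c \<le> freq (\<Omega> (\<rho> n)) (B k l)"
    proof eventually_elim
      case (elim n)
      have "freq (\<Omega> (\<rho> n)) (A k) \<le> freq (\<Omega> (\<rho> n)) (B k l)"
        using that by (intro freq_mono fin) (auto simp: B_def)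
      with elim show ?case by linarith
    qed
  qed simp
  define s where "s k = (SUP l. b k l)" for k
  have bs: "b k l \<le> s k" for k l
    unfolding s_def by (rule cSUP_upper) (use b1 in \<open>auto simp: bdd_above_def\<close>)
  \<comment> \<open>Enlarging a near-optimal \<open>l\<close> beyond \<open>k\<close> keeps the
    estimate, since limit frequencies increase with \<open>l\<close>, and makes the block
    nonempty.\<close>
  have "\<exists>l>k. s k - c / 2 ^ (k + 2) < b k l" for k
  proof -
    have "s k - c / 2 ^ (k + 2) < (SUP l. b k l)" using c by (simp add: s_def)
    then obtain l where l: "s k - c / 2 ^ (k + 2) < b k l"
      using b1 by (subst (asm) less_cSUP_iff) (auto simp: bdd_above_def)
    have "b k l \<le> b k (max l (Suc k))"
      by (rule LIMSEQ_le[OF lim lim]) (auto simp: B_def intro!: freq_mono fin exI[of _ 0])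
    with l show ?thesis by (intro exI[of _ "max l (Suc k)"]) auto
  qed
  then obtain l where l: "\<And>k. k < l k" "\<And>k. s k - c / 2 ^ (k + 2) < b k (l k)" by metis
  define k where "k i = (l ^^ i) 0" for i
  have kS: "k (Suc i) = l (k i)" for i by (simp add: k_def)
  have k: "strict_mono k" using l(1) by (simp add: strict_mono_Suc_iff kS)
  have "(\<Inter>i\<le>I. B (k i) (k (Suc i))) \<noteq> {}" for I
  proof
    assume empty: "(\<Inter>i\<le>I. B (k i) (k (Suc i))) = {}"
    have le: "freq (\<Omega> n) (B (k I) (k (Suc I)))
        \<le> (\<Sum>i<I. freq (\<Omega> n) (B (k i) (k (Suc I))) - freq (\<Omega> n) (B (k i) (k (Suc i))))" for n
    proof -
      have sub: "B (k i) (k (Suc i)) \<subseteq> B (k i) (k (Suc I))" "B (k I) (k (Suc I)) \<subseteq> B (k i) (k (Suc I))"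
        if "i < I" for i
      proof -
        have "k (Suc i) \<le> k (Suc I)" "k i \<le> k I" using that k by (auto simp: strict_mono_less_eq)
        then show "B (k i) (k (Suc i)) \<subseteq> B (k i) (k (Suc I))" "B (k I) (k (Suc I)) \<subseteq> B (k i) (k (Suc I))"
          by (force simp: B_def)+
      qed
      \<comment> \<open>A point of the last block lies in every union that starts earlier and runs
        up to \<open>k (Suc I)\<close>. Without a common point it misses some earlier block, hence
        falls into what extending that block gains.\<close>
      have "B (k I) (k (Suc I)) \<subseteq> (\<Union>i\<in>{..<I}. B (k i) (k (Suc I)) - B (k i) (k (Suc i)))"
      proof
        fix x assume x: "x \<in> B (k I) (k (Suc I))"
        then obtain i where i: "i \<le> I" "x \<notin> B (k i) (k (Suc i))" using empty by auto
        with x have "i < I" by (cases "i = I") auto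
        with i x sub show "x \<in> (\<Union>i\<in>{..<I}. B (k i) (k (Suc I)) - B (k i) (k (Suc i)))" by blast
      qed
      then have "freq (\<Omega> n) (B (k I) (k (Suc I)))
          \<le> freq (\<Omega> n) (\<Union>i\<in>{..<I}. B (k i) (k (Suc I)) - B (k i) (k (Suc i)))"
        by (intro freq_mono fin)
      also have "\<dots> \<le> (\<Sum>i<I. freq (\<Omega> n) (B (k i) (k (Suc I)) - B (k i) (k (Suc i))))"
        by (intro freq_UN_le fin) simp
      also have "\<dots> = (\<Sum>i<I. freq (\<Omega> n) (B (k i) (k (Suc I))) - freq (\<Omega> n) (B (k i) (k (Suc i))))"
        using sub by (intro sum.cong freq_Diff fin) auto
      finally show ?thesis .
    qed
    have "b (k I) (k (Suc I)) \<le> (\<Sum>i<I. b (k i) (k (Suc I)) - b (k i) (k (Suc i)))"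
      by (rule LIMSEQ_le[OF lim tendsto_sum[OF tendsto_diff[OF lim lim]]]) (use le in auto)
    \<comment> \<open>The gains sum to less than \<open>c\<close>, because
      \<open>i \<le> k i\<close>, while the last block has limit frequency at least
      \<open>c\<close>.\<close>
    also have "\<dots> \<le> (\<Sum>i<I. c / 2 ^ (i + 2))"
    proof (rule sum_mono)
      fix i
      have "c / 2 ^ (k i + 2) \<le> c / 2 ^ (i + 2)"
        using c strict_mono_imp_increasing[OF k, of i]
        by (intro divide_left_mono power_increasing) auto
      then show "b (k i) (k (Suc I)) - b (k i) (k (Suc i)) \<le> c / 2 ^ (i + 2)"
        using l(2)[of "k i"] bs[of "k i" "k (Suc I)"] by (simp add: kS)
    qed
    also have "\<dots> = c / 2 * (1 - 1 / 2 ^ I)"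
      by (induction I) (auto simp: field_simps)
    also have "\<dots> < c" using c by (simp add: field_simps add_pos_pos)
    finally show False using bc[of "k I" "k (Suc I)"] k by (simp add: strict_mono_less)
  qed
  with k show ?thesis by (auto simp: B_def)
qed

section \<open>Group actions on compact spaces\<close>

locale compact_group_action = group_action G X \<phi>
  for G (structure) and X :: "'x::metric_space set" and \<phi> +
  assumes compact: "compact X"
    and cont: "g \<in> carrier G \<Longrightarrow> continuous_on X (\<phi> g)"
begin

sublocale group G
  using group_hom group_hom.axioms(1) by auto

lemma action_closed: "g \<in> carrier G \<Longrightarrow> x \<in> X \<Longrightarrow> \<phi> g x \<in> X"
  using element_image by blast

lemma dist_bound:
  obtains M where "0 \<le> M" "\<And>x y. x \<in> X \<Longrightarrow> y \<in> X \<Longrightarrow> dist x y \<le> M"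
proof -
  obtain M where "\<forall>x\<in>X. \<forall>y\<in>X. dist x y \<le> M"
    using compact_imp_bounded[OF compact] bounded_two_points by blast
  then show ?thesis by (intro that[of "max 0 M"]) (auto simp: le_max_iff_disj)
qed

lemma r_coset_image: "H #>\<^bsub>G\<^esub> g = (\<lambda>h. h \<otimes> g) ` H"
  by (auto simp: r_coset_def)

lemma l_coset_image: "g <#\<^bsub>G\<^esub> H = (\<lambda>h. g \<otimes> h) ` H"
  by (auto simp: l_coset_def)

lemma inj_on_mult_right: "H \<subseteq> carrier G \<Longrightarrow> g \<in> carrier G \<Longrightarrow> inj_on (\<lambda>h. h \<otimes> g) H"
  by (auto simp: inj_on_def subset_iff)

lemma inj_on_mult_left: "H \<subseteq> carrier G \<Longrightarrow> g \<in> carrier G \<Longrightarrow> inj_on (\<lambda>h. g \<otimes> h) H"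
  by (auto simp: inj_on_def subset_iff)

section \<open>Folner sequences and averages along orbits\<close>

lemma Folner_seqD:
  assumes "Folner_sequence G F"
  shows "F n \<subseteq> carrier G" "finite (F n)" "F n \<noteq> {}" "0 < card (F n)"
  using assms by (auto simp: Folner_sequence_def Fin_def card_gt_0_iff)

lemma eventually_sym_diff_le:
  fixes e :: real
  assumes F: "Folner_sequence G F" and H: "finite H" "H \<subseteq> carrier G" and e: "0 < e"
  shows "\<forall>\<^sub>F n in sequentially. \<forall>h\<in>H. card (sym_diff (h <#\<^bsub>G\<^esub> F n) (F n)) \<le> e * card (F n)"
proof (rule eventually_ball_finite[OF H(1)], rule ballI)
  fix h assume "h \<in> H"
  then have "(\<lambda>n. real (card (sym_diff (h <#\<^bsub>G\<^esub> F n) (F n))) / real (card (F n))) \<longlonglongrightarrow> 0"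
    using F H by (auto simp: Folner_sequence_def)
  then have "\<forall>\<^sub>F n in sequentially. real (card (sym_diff (h <#\<^bsub>G\<^esub> F n) (F n))) / real (card (F n)) < e"
    using e by (rule order_tendstoD)
  then show "\<forall>\<^sub>F n in sequentially. card (sym_diff (h <#\<^bsub>G\<^esub> F n) (F n)) \<le> e * card (F n)"
    by eventually_elim (use Folner_seqD(4)[OF F] in \<open>simp add: pos_divide_less_eq less_imp_le\<close>)
qed

text \<open>Take \<open>N + 1\<close> group elements \<open>H\<close>. If \<open>F n\<close> had at
  most \<open>N\<close> elements, a relative Folner error of \<open>1 / (2 * (N + 1))\<close> would
  be less than one element, so \<open>F n\<close> would contain every \<open>h \<otimes> f\<close>
  with \<open>h\<close> in \<open>H\<close> and thus have more than \<open>N\<close>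
  elements.\<close>

lemma Folner_card_at_top:
  assumes F: "Folner_sequence G F" and inf: "infinite (carrier G)"
  shows "filterlim (\<lambda>n. real (card (F n))) at_top sequentially"
proof -
  have "\<forall>\<^sub>F n in sequentially. N < card (F n)" for N
  proof -
    obtain H where H: "H \<subseteq> carrier G" "finite H" "card H = Suc N"
      using infinite_arbitrarily_large[OF inf] by blast
    have "\<forall>\<^sub>F n in sequentially. \<forall>h\<in>H. card (sym_diff (h <#\<^bsub>G\<^esub> F n) (F n)) \<le> 1 / (2 * real (Suc N)) * card (F n)"
      using H by (intro eventually_sym_diff_le[OF F, of H "1 / (2 * real (Suc N))"]) auto
    then show ?thesis
    proof eventually_elim
      case (elim n)
      note Fn = Folner_seqD[OF F, of n]
      show ?case
      proof (rule ccontr)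
        assume small: "\<not> N < card (F n)"
        obtain f where f: "f \<in> F n" using Fn by auto
        have "h \<otimes> f \<in> F n" if h: "h \<in> H" for h
        proof -
          have "1 / (2 * real (Suc N)) * card (F n) < 1" using small by (simp add: field_simps)
          moreover have "real (card (sym_diff (h <#\<^bsub>G\<^esub> F n) (F n))) \<le> 1 / (2 * real (Suc N)) * card (F n)"
            using elim h by blast
          ultimately have "card (sym_diff (h <#\<^bsub>G\<^esub> F n) (F n)) < 1" by linarith
          then have "sym_diff (h <#\<^bsub>G\<^esub> F n) (F n) = {}"
            using Fn(2) by (simp add: l_coset_image)
          then show ?thesis using f by (auto simp: l_coset_image)
        qed
        then have "(\<lambda>h. h \<otimes> f) ` H \<subseteq> F n" by auto
        then have "card H \<le> card (F n)"
          using inj_on_mult_right[OF H(1)] Fn f by (metis card_inj_on_le subsetD)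
        with small H show False by simp
      qed
    qed
  qed
  then have "filterlim (\<lambda>n. card (F n)) at_top sequentially"
    unfolding filterlim_at_top by (meson eventually_mono less_imp_le)
  then show ?thesis
    by (rule filterlim_compose[OF filterlim_real_sequentially])
qed

text \<open>Averaging the windows \<open>H #>\<^bsub>G\<^esub> g\<close> over \<open>g \<in> F n\<close> recovers the average over \<open>F n\<close> up to
  a Folner error, so a single good \<open>H\<close> controls all late Folner averages.\<close>

lemma Dbar_less_imp_eventually_average_less:
  assumes F: "Folner_sequence G F" and x: "x \<in> X" and y: "y \<in> X" and D: "Dbar G \<phi> x y < e"
  shows "\<forall>\<^sub>F n in sequentially. (\<Sum>t\<in>F n. dist (\<phi> t x) (\<phi> t y)) < 2 * e * card (F n)"
proof -
  obtain M where M: "0 \<le> M" "\<And>x y. x \<in> X \<Longrightarrow> y \<in> X \<Longrightarrow> dist x y \<le> M"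
    using dist_bound by blast
  define d where "d t = dist (\<phi> t x) (\<phi> t y)" for t
  have d: "0 \<le> d t" "t \<in> carrier G \<Longrightarrow> d t \<le> M" for t
    using M action_closed x y by (auto simp: d_def)
  have "Fin G \<noteq> {}" using Folner_sequence_def F by blast
  with D obtain H where H: "H \<in> Fin G"
    "(SUP g\<in>carrier G. (1 / real (card H)) * (\<Sum>t\<in>H #>\<^bsub>G\<^esub> g. d t)) < e"
    unfolding Dbar_def d_def by (metis (no_types, lifting) cInf_lessD empty_is_image imageE)
  define s where "s = (SUP g\<in>carrier G. (1 / real (card H)) * (\<Sum>t\<in>H #>\<^bsub>G\<^esub> g. d t))"
  have Hc: "H \<subseteq> carrier G" "finite H" "card H > 0" using H by (auto simp: Fin_def card_gt_0_iff)
  have shift: "(\<Sum>t\<in>H #>\<^bsub>G\<^esub> g. d t) = (\<Sum>h\<in>H. d (h \<otimes> g))" if "g \<in> carrier G" for g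
    using inj_on_mult_right[OF Hc(1) that] by (simp add: r_coset_image sum.reindex)
  have le_s: "(\<Sum>h\<in>H. d (h \<otimes> g)) \<le> s * card H" if g: "g \<in> carrier G" for g
  proof -
    have "(1 / real (card H)) * (\<Sum>t\<in>H #>\<^bsub>G\<^esub> g. d t) \<le> s"
      unfolding s_def
    proof (rule cSUP_upper[OF g])
      have "(1 / real (card H)) * (\<Sum>t\<in>H #>\<^bsub>G\<^esub> g. d t) \<le> M" if g: "g \<in> carrier G" for g
      proof -
        have "(\<Sum>h\<in>H. d (h \<otimes> g)) \<le> (\<Sum>h\<in>H. M)"
          using Hc g by (intro sum_mono d) auto
        then show ?thesis using Hc by (simp add: shift[OF g] field_simps)
      qed
      then show "bdd_above ((\<lambda>g. (1 / real (card H)) * (\<Sum>t\<in>H #>\<^bsub>G\<^esub> g. d t)) ` carrier G)"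
        by (auto simp: bdd_above_def)
    qed
    then show ?thesis using Hc by (simp add: shift[OF g] field_simps)
  qed
  have s0: "0 \<le> s"
  proof -
    have "0 \<le> (\<Sum>h\<in>H. d (h \<otimes> \<one>))" using d by (intro sum_nonneg) auto
    also have "\<dots> \<le> s * card H" by (rule le_s) simp
    finally show ?thesis using Hc by (auto simp: zero_le_mult_iff)
  qed
  have e: "s < e" "0 < e" using H(2) s0 by (auto simp: s_def)
  \<comment> \<open>Each \<open>d t\<close> is at most \<open>M\<close>, so the points of
    \<open>F n\<close> missed by a translate cost at most \<open>e * card (F n)\<close>;
    \<open>M + 1\<close> avoids division by zero.\<close>
  have "\<forall>\<^sub>F n in sequentially. \<forall>h\<in>H. card (sym_diff (h <#\<^bsub>G\<^esub> F n) (F n)) \<le> e / (M + 1) * card (F n)"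
    using M e Hc by (intro eventually_sym_diff_le[OF F]) auto
  then show ?thesis
  proof eventually_elim
    case (elim n)
    note Fn = Folner_seqD[OF F, of n]
    have *: "(\<Sum>t\<in>F n. d t) \<le> (\<Sum>g\<in>F n. d (h \<otimes> g)) + e * card (F n)" if h: "h \<in> H" for h
    proof -
      have hc: "h \<in> carrier G" using h Hc by auto
      have hF: "h <#\<^bsub>G\<^esub> F n \<subseteq> carrier G" "finite (h <#\<^bsub>G\<^esub> F n)"
        using Fn hc by (auto simp: l_coset_image)
      have "(\<Sum>t\<in>F n. d t) \<le> (\<Sum>t\<in>(h <#\<^bsub>G\<^esub> F n) \<union> (F n - (h <#\<^bsub>G\<^esub> F n)). d t)"
        using Fn hF d by (intro sum_mono2) auto
      also have "\<dots> = (\<Sum>t\<in>h <#\<^bsub>G\<^esub> F n. d t) + (\<Sum>t\<in>F n - (h <#\<^bsub>G\<^esub> F n). d t)"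
        using Fn hF by (intro sum.union_disjoint) auto
      also have "(\<Sum>t\<in>h <#\<^bsub>G\<^esub> F n. d t) = (\<Sum>g\<in>F n. d (h \<otimes> g))"
        using inj_on_mult_left[OF Fn(1) hc] by (simp add: l_coset_image sum.reindex)
      also have "(\<Sum>t\<in>F n - (h <#\<^bsub>G\<^esub> F n). d t) \<le> card (F n - (h <#\<^bsub>G\<^esub> F n)) * M"
        using Fn d by (intro sum_bounded_above) auto
      also have "\<dots> \<le> e / (M + 1) * card (F n) * M"
      proof (rule mult_right_mono[OF _ M(1)])
        have "card (F n - (h <#\<^bsub>G\<^esub> F n)) \<le> card (sym_diff (h <#\<^bsub>G\<^esub> F n) (F n))"
          using Fn hF by (intro card_mono) auto
        with elim h show "card (F n - (h <#\<^bsub>G\<^esub> F n)) \<le> e / (M + 1) * card (F n)" by fastforce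
      qed
      also have "\<dots> \<le> e * card (F n)"
        using M e by (simp add: field_simps)
      finally show ?thesis by simp
    qed
    have "card H * (\<Sum>t\<in>F n. d t) \<le> (\<Sum>h\<in>H. (\<Sum>g\<in>F n. d (h \<otimes> g)) + e * card (F n))"
      using sum_mono[of H "\<lambda>_. \<Sum>t\<in>F n. d t", OF *] by simp
    also have "\<dots> = (\<Sum>g\<in>F n. \<Sum>h\<in>H. d (h \<otimes> g)) + card H * (e * card (F n))"
      by (subst sum.swap) (simp add: sum.distrib)
    also have "\<dots> \<le> (\<Sum>g\<in>F n. s * card H) + card H * (e * card (F n))"
      using Fn by (intro add_right_mono sum_mono le_s) auto
    also have "\<dots> = card H * ((s + e) * card (F n))" by (simp add: algebra_simps)
    finally have "(\<Sum>t\<in>F n. d t) \<le> (s + e) * card (F n)" using Hc by simp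
    also have "\<dots> < 2 * e * card (F n)" using e Fn by (intro mult_strict_right_mono) auto
    finally show ?case by (simp add: d_def)
  qed
qed

section \<open>Hamming-separated sets and cover numbers\<close>

text \<open>Finitely many uniformly continuous maps share one modulus \<delta>, so a finite
  \<delta>-net of \<open>X\<close> is an \<open>L\<close>-net for the Bowen metric of
  \<open>T\<close>.\<close>

lemma finite_Bowen_net:
  assumes T: "finite T" "T \<subseteq> carrier G" and L: "0 < L"
  obtains Y where "finite Y" "Y \<subseteq> X" "\<And>x. x \<in> X \<Longrightarrow> \<exists>y\<in>Y. \<forall>t\<in>T. dist (\<phi> t x) (\<phi> t y) < L"
proof -
  have "\<exists>\<delta>>0. \<forall>x\<in>X. \<forall>y\<in>X. dist x y < \<delta> \<longrightarrow> (\<forall>t\<in>T. dist (\<phi> t x) (\<phi> t y) < L)"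
    using T
  proof (induction T)
    case empty
    show ?case by (intro exI[of _ 1]) auto
  next
    case (insert t T)
    then obtain \<delta> where \<delta>: "\<delta> > 0" "\<forall>x\<in>X. \<forall>y\<in>X. dist x y < \<delta> \<longrightarrow> (\<forall>t\<in>T. dist (\<phi> t x) (\<phi> t y) < L)" by auto
    have "uniformly_continuous_on X (\<phi> t)"
      using insert.prems by (intro compact_uniformly_continuous cont compact) auto
    then obtain \<delta>' where "\<delta>' > 0" "\<forall>x\<in>X. \<forall>y\<in>X. dist y x < \<delta>' \<longrightarrow> dist (\<phi> t y) (\<phi> t x) < L"
      using L unfolding uniformly_continuous_on_def by blast
    with \<delta> show ?case by (intro exI[of _ "min \<delta> \<delta>'"]) auto
  qed
  then obtain \<delta> where \<delta>: "\<delta> > 0" "\<And>x y. x \<in> X \<Longrightarrow> y \<in> X \<Longrightarrow> dist x y < \<delta> \<Longrightarrow> \<forall>t\<in>T. dist (\<phi> t x) (\<phi> t y) < L"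
    by blast
  obtain Y where Y: "Y \<subseteq> X" "finite Y" "X \<subseteq> (\<Union>y\<in>Y. ball y \<delta>)"
    by (rule compactE_image[OF compact, of X "\<lambda>y. ball y \<delta>"]) (use \<delta> in auto)
  show ?thesis
  proof (rule that[OF Y(2,1)])
    fix x assume x: "x \<in> X"
    then obtain y where "y \<in> Y" "dist x y < \<delta>" using Y by (auto simp: dist_commute)
    then show "\<exists>y\<in>Y. \<forall>t\<in>T. dist (\<phi> t x) (\<phi> t y) < L" using \<delta>(2)[OF x, of y] Y by blast
  qed
qed

text \<open>The proportion \<open>card (far L T x y) / card T\<close> acts as a Hamming distance
  between orbit segments; a Bowen metric would only tell whether this set is empty.\<close>

definition far :: "real \<Rightarrow> 'a set \<Rightarrow> 'x \<Rightarrow> 'x \<Rightarrow> 'a set" where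
  "far L T x y = {t\<in>T. L \<le> dist (\<phi> t x) (\<phi> t y)}"

lemma far_commute: "far L T x y = far L T y x"
  by (simp add: far_def dist_commute)

text \<open>Off a proportion \<epsilon> of the times, every orbit segment over \<open>T\<close> is
  \<open>2 * L\<close>-close to that of some point of a maximal Hamming-separated set
  \<open>E\<close>. Its itinerary through the cover can then be taken in a Hamming ball around a
  word read off from that point, and \<open>hamming_ball_card\<close> counts these words.\<close>

lemma cover_number_le_separated:
  fixes L \<theta> \<epsilon> :: real
  assumes T: "finite T" "T \<noteq> {}" "T \<subseteq> carrier G" and U: "\<U> \<in> finite_open_covers X"
    and L: "0 < L" "\<And>x. x \<in> X \<Longrightarrow> \<exists>A\<in>\<U>. \<forall>y\<in>X. dist x y < 2 * L \<longrightarrow> y \<in> A"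
    and \<theta>: "0 < \<theta>" "\<theta> < 1" and \<epsilon>: "0 \<le> \<epsilon>"
  obtains E where "finite E" "E \<subseteq> X"
    "\<And>x y. x \<in> E \<Longrightarrow> y \<in> E \<Longrightarrow> x \<noteq> y \<Longrightarrow> \<epsilon> * card T < card (far L T x y)"
    "cover_number X (cover_join T (\<lambda>s. translate_cover G \<phi> s \<U>))
       \<le> card E * exp (card T * (\<epsilon> * ln (1 / \<theta>) + \<theta> * card \<U>))"
proof -
  obtain Y where Y: "finite Y" "Y \<subseteq> X" "\<And>x. x \<in> X \<Longrightarrow> \<exists>y\<in>Y. \<forall>t\<in>T. dist (\<phi> t x) (\<phi> t y) < L"
    using finite_Bowen_net[OF T(1,3) L(1)] by blast
  \<comment> \<open>Searching inside a finite net provides a maximal element; the price is one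
    \<open>L\<close> in the scale, since a point \<open>y\<close> is first replaced by a net point
    \<open>z\<close>.\<close>
  define S where "S = {E. E \<subseteq> Y \<and> (\<forall>x\<in>E. \<forall>y\<in>E. x \<noteq> y \<longrightarrow> \<epsilon> * card T < card (far L T x y))}"
  have "finite S" "S \<noteq> {}" using Y(1) by (auto simp: S_def)
  then obtain E where E: "E \<in> S" and max: "\<And>E'. E' \<in> S \<Longrightarrow> E \<subseteq> E' \<Longrightarrow> E = E'"
    using finite_has_maximal by metis
  have EY: "E \<subseteq> Y" "finite E" "E \<subseteq> X"
    and sep: "\<And>x y. x \<in> E \<Longrightarrow> y \<in> E \<Longrightarrow> x \<noteq> y \<Longrightarrow> \<epsilon> * card T < card (far L T x y)"
    using E Y finite_subset by (auto simp: S_def)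
  have near: "\<exists>x\<in>E. card (far (2 * L) T x y) \<le> \<epsilon> * card T" if y: "y \<in> X" for y
  proof -
    obtain z where z: "z \<in> Y" "\<And>t. t \<in> T \<Longrightarrow> dist (\<phi> t y) (\<phi> t z) < L" using Y(3)[OF y] by blast
    have "\<exists>x\<in>E. card (far L T x z) \<le> \<epsilon> * card T"
    proof (rule ccontr)
      assume "\<not> ?thesis"
      then have *: "\<epsilon> * card T < card (far L T x z)" if "x \<in> E" for x using that by force
      then have "\<epsilon> * card T < card (far L T z x)" if "x \<in> E" for x
        using that by (subst far_commute) blast
      with * have "insert z E \<in> S"
        using E z(1) by (auto simp: S_def)
      with max have "z \<in> E" by blast
      from *[OF this] have "\<epsilon> * card T < 0" using L by (simp add: far_def)
      then show False using \<epsilon> by (simp add: mult_less_0_iff)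
    qed
    then obtain x where x: "x \<in> E" "card (far L T x z) \<le> \<epsilon> * card T" by blast
    have "far (2 * L) T x y \<subseteq> far L T x z"
    proof
      fix t assume t: "t \<in> far (2 * L) T x y"
      then have "dist (\<phi> t x) (\<phi> t y) \<le> dist (\<phi> t x) (\<phi> t z) + dist (\<phi> t y) (\<phi> t z)"
        by (simp add: dist_triangle2)
      with t z(2)[of t] show "t \<in> far L T x z" by (auto simp: far_def)
    qed
    then have "card (far (2 * L) T x y) \<le> card (far L T x z)"
      using T by (intro card_mono) (auto simp: far_def)
    with x show ?thesis by (intro bexI[of _ x]) auto
  qed
  have finU: "finite \<U>" "\<And>A. A \<in> \<U> \<Longrightarrow> A \<subseteq> X" "\<Union>\<U> = X" using U by (auto simp: finite_open_covers_def)
  have "\<forall>x\<in>X. \<exists>A. A \<in> \<U> \<and> (\<forall>y\<in>X. dist x y < 2 * L \<longrightarrow> y \<in> A)" using L(2) by blast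
  from bchoice[OF this] obtain N where N: "\<And>x. x \<in> X \<Longrightarrow> N x \<in> \<U>"
    "\<And>x y. x \<in> X \<Longrightarrow> y \<in> X \<Longrightarrow> dist x y < 2 * L \<Longrightarrow> y \<in> N x" by blast
  define H where "H x = {C \<in> T \<rightarrow>\<^sub>E \<U>. card {t\<in>T. C t \<noteq> N (\<phi> t x)} \<le> \<epsilon> * card T}" for x
  \<comment> \<open>For a word \<open>C\<close> in the cover, this is the set of points of
    \<open>X\<close> that admit \<open>C\<close> as an itinerary over \<open>T\<close>.\<close>
  define cell where "cell C = (\<Inter>s\<in>T. \<phi> (inv s) ` C s)" for C
  have fin: "finite (T \<rightarrow>\<^sub>E \<U>)" using T finU by (intro finite_PiE) auto
  have finH: "finite (H x)" for x unfolding H_def using fin by auto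
  have cardH: "card (H x) \<le> exp (card T * (\<epsilon> * ln (1 / \<theta>) + \<theta> * card \<U>))" if "x \<in> E" for x
    unfolding H_def using T EY that action_closed
    by (intro hamming_ball_card finU \<theta> N(1)) (auto simp: subset_iff)
  define \<V> where "\<V> = cell ` (\<Union>x\<in>E. H x)"
  have "\<V> \<subseteq> cover_join T (\<lambda>s. translate_cover G \<phi> s \<U>)"
  proof
    fix V assume "V \<in> \<V>"
    then obtain C where C: "C \<in> T \<rightarrow>\<^sub>E \<U>" "V = cell C" by (auto simp: \<V>_def H_def)
    define c where "c = (\<lambda>s\<in>T. \<phi> (inv s) ` C s)"
    have "c \<in> (\<Pi>\<^sub>E s\<in>T. translate_cover G \<phi> s \<U>)"
      using C(1) by (auto simp: c_def translate_cover_def PiE_iff)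
    moreover have "V = (\<Inter>s\<in>T. c s)" using C(2) by (simp add: c_def cell_def)
    ultimately show "V \<in> cover_join T (\<lambda>s. translate_cover G \<phi> s \<U>)"
      unfolding cover_join_def by blast
  qed
  moreover have "finite \<V>" using EY finH by (simp add: \<V>_def)
  moreover have "\<Union>\<V> = X"
  proof
    \<comment> \<open>Nonemptiness of \<open>T\<close> matters: an empty intersection would be the
      whole type.\<close>
    have "cell C \<subseteq> X" if "C \<in> T \<rightarrow>\<^sub>E \<U>" for C
    proof -
      obtain s where s: "s \<in> T" using T by blast
      then have "cell C \<subseteq> \<phi> (inv s) ` X" using that finU(2) by (fastforce simp: cell_def PiE_iff)
      also have "\<dots> = X" using s T by (intro surj_prop) auto
      finally show ?thesis .
    qed
    then show "\<Union>\<V> \<subseteq> X" by (auto simp: \<V>_def H_def)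
    show "X \<subseteq> \<Union>\<V>"
    proof
      fix y assume y: "y \<in> X"
      obtain x where x: "x \<in> E" "card (far (2 * L) T x y) \<le> \<epsilon> * card T" using near[OF y] by blast
      have "\<exists>A\<in>\<U>. \<phi> t y \<in> A" if "t \<in> T" for t
      proof -
        have "\<phi> t y \<in> \<Union>\<U>" using y T that unfolding finU(3) by (blast intro: action_closed)
        then show ?thesis by blast
      qed
      then have "\<forall>t\<in>T. \<exists>A. A \<in> \<U> \<and> \<phi> t y \<in> A" by blast
      from bchoice[OF this] obtain B where B: "\<And>t. t \<in> T \<Longrightarrow> B t \<in> \<U>" "\<And>t. t \<in> T \<Longrightarrow> \<phi> t y \<in> B t" by blast
      \<comment> \<open>The word of \<open>y\<close> copies the Lebesgue sets of \<open>x\<close>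
        where the orbits are \<open>2 * L\<close>-close, and elsewhere uses any member of the cover
        containing \<open>\<phi> t y\<close>.\<close>
      define C where "C = (\<lambda>t\<in>T. if t \<in> far (2 * L) T x y then B t else N (\<phi> t x))"
      have tc: "\<phi> t x \<in> X" "\<phi> t y \<in> X" if "t \<in> T" for t
        using x EY y T that by (blast intro: action_closed)+
      have "card {t\<in>T. C t \<noteq> N (\<phi> t x)} \<le> card (far (2 * L) T x y)"
        using T by (intro card_mono) (auto simp: C_def far_def)
      with x(2) have "C \<in> H x" using B N(1) tc by (auto simp: H_def C_def)
      moreover have "y \<in> cell C"
        unfolding cell_def
      proof
        fix t assume t: "t \<in> T"
        have "\<phi> t y \<in> C t" using B(2)[OF t] N(2)[of "\<phi> t x" "\<phi> t y"] tc t
          by (auto simp: C_def far_def)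
        moreover have "\<phi> (inv t) (\<phi> t y) = y" using orbit_sym_aux[of t y] t T y by auto
        ultimately show "y \<in> \<phi> (inv t) ` C t" by (metis imageI)
      qed
      ultimately show "y \<in> \<Union>\<V>" using x by (auto simp: \<V>_def)
    qed
  qed
  ultimately have "cover_number X (cover_join T (\<lambda>s. translate_cover G \<phi> s \<U>)) \<le> card \<V>"
    unfolding cover_number_def by (intro Least_le) blast
  also have "card \<V> \<le> (\<Sum>x\<in>E. card (H x))"
    unfolding \<V>_def using EY finH by (intro order.trans[OF card_image_le card_UN_le]) auto
  finally have "real (cover_number X (cover_join T (\<lambda>s. translate_cover G \<phi> s \<U>))) \<le> (\<Sum>x\<in>E. real (card (H x)))"
    by (metis of_nat_le_iff of_nat_sum)
  also have "\<dots> \<le> card E * exp (card T * (\<epsilon> * ln (1 / \<theta>) + \<theta> * card \<U>))"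
    using cardH by (intro sum_bounded_above)
  finally show ?thesis using that[of E] EY sep by blast
qed

section \<open>Tuples spread on a window\<close>

text \<open>A tuple is stored with the group element that moves it: frequencies become counts in a
  product of tuples and \<open>A\<close>, and one pair \<open>(xs, g)\<close> can belong to these
  sets for many \<open>T\<close>.\<close>

definition spread_tuples :: "real \<Rightarrow> real \<Rightarrow> nat \<Rightarrow> 'a set \<Rightarrow> ('x list \<times> 'a) set" where
  "spread_tuples \<kappa> L m T = {(xs, g). g \<in> carrier G \<and> set xs \<subseteq> X \<and> length xs = Suc m \<and>
     sorted_wrt (\<lambda>x y. \<kappa> * card T \<le> card (far L T (\<phi> g x) (\<phi> g y))) xs}"

text \<open>By \<open>card_le_if_windows_concentrated\<close>, a large \<open>E\<close> forces more
  than a proportion \<beta> of the \<open>g\<close> in \<open>A\<close> to be unconcentrated. Each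
  of them has at least \<open>(\<beta> * card E) ^ Suc m\<close> spread tuples, whence the exponent
  \<open>m + 2\<close>.\<close>

lemma freq_spread_tuples_ge:
  fixes \<epsilon> \<eta> \<beta> \<kappa> K L :: real
  assumes A: "finite A" "A \<noteq> {}" "A \<subseteq> carrier G" and T: "finite T" "T \<noteq> {}" "T \<subseteq> carrier G"
    and TA: "card T \<le> card A"
    and inv_A: "\<And>s. s \<in> T \<Longrightarrow> card (sym_diff (s <#\<^bsub>G\<^esub> A) A) \<le> \<eta> / card T * card A"
    and E: "finite E" "E \<subseteq> X"
    and sep: "\<And>x y. x \<in> E \<Longrightarrow> y \<in> E \<Longrightarrow> x \<noteq> y \<Longrightarrow> \<epsilon> * card A < card (far L A x y)"
    and pos: "0 < K" "0 \<le> \<beta>" "0 \<le> \<kappa>"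
    and const: "\<eta> + 3 * exp (- K) + 6 * \<beta> * (K + 1) + 2 * \<kappa> * (K + 1) \<le> \<epsilon>"
    and large: "2 * (m + 1) ^ nat \<lceil>K * card A / card T\<rceil> < card E"
  shows "\<beta> ^ (m + 2) \<le> freq ({xs. set xs \<subseteq> E \<and> length xs = Suc m} \<times> A) (spread_tuples \<kappa> (L / 2) m T)"
proof -
  define near where "near g x y \<longleftrightarrow> card (far (L / 2) T (\<phi> g x) (\<phi> g y)) < \<kappa> * card T" for g x y
  define W where "W g = (\<lambda>t. t \<otimes> g) ` T" for g
  \<comment> \<open>For \<open>t\<close> in \<open>U\<close>, every
    \<open>g = inv s \<otimes> t\<close> with \<open>s \<in> T\<close> lies in \<open>A\<close> and
    has \<open>t\<close> in its window \<open>W g\<close>; this gives the covering multiplicity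
    \<open>card T\<close>.\<close>
  define U where "U = {t\<in>A. \<forall>s\<in>T. inv s \<otimes> t \<in> A}"
  define S where "S = {g\<in>A. \<not> (\<exists>Y\<subseteq>E. card Y \<le> m \<and> card {x\<in>E. \<forall>y\<in>Y. \<not> near g x y} \<le> \<beta> * card E)}"
  have cT: "0 < card T" and cA: "0 < card A" using T A by (simp_all add: card_gt_0_iff)
  have cE: "0 < card E" using large by linarith
  have cardS: "\<beta> * card A < card S"
  proof (rule ccontr)
    assume "\<not> ?thesis"
    then have S_le: "card S \<le> \<beta> * card A" by simp
    have "card E \<le> 2 * (m + 1) ^ nat \<lceil>K * card A / card T\<rceil>"
    proof (rule card_le_if_windows_concentrated[where U = U and W = W and near = near and D = "far L A"
          and \<epsilon> = \<epsilon> and \<eta> = \<eta> and \<beta> = \<beta> and \<kappa> = \<kappa>, OF A(1,2) E(1) cT TA])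
      show "U \<subseteq> A" by (auto simp: U_def)
      have "A - U \<subseteq> (\<Union>s\<in>T. sym_diff (s <#\<^bsub>G\<^esub> A) A)"
      proof
        fix t assume t: "t \<in> A - U"
        then obtain s where s: "s \<in> T" "inv s \<otimes> t \<notin> A" by (auto simp: U_def)
        have "t \<notin> s <#\<^bsub>G\<^esub> A"
        proof
          assume "t \<in> s <#\<^bsub>G\<^esub> A"
          then obtain a where "a \<in> A" "t = s \<otimes> a" by (auto simp: l_coset_image)
          moreover have "inv s \<otimes> (s \<otimes> a) = a"
            using s T A \<open>a \<in> A\<close> by (simp add: subset_iff m_assoc[symmetric])
          ultimately show False using s by simp
        qed
        with s t show "t \<in> (\<Union>s\<in>T. sym_diff (s <#\<^bsub>G\<^esub> A) A)" by blast
      qed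
      then have "card (A - U) \<le> card (\<Union>s\<in>T. sym_diff (s <#\<^bsub>G\<^esub> A) A)"
        using T A by (intro card_mono) (auto simp: l_coset_image)
      also have "\<dots> \<le> (\<Sum>s\<in>T. card (sym_diff (s <#\<^bsub>G\<^esub> A) A))"
        using T by (intro card_UN_le)
      finally have "real (card (A - U)) \<le> (\<Sum>s\<in>T. real (card (sym_diff (s <#\<^bsub>G\<^esub> A) A)))"
        by (metis of_nat_le_iff of_nat_sum)
      also have "\<dots> \<le> card T * (\<eta> / card T * card A)"
        using inv_A by (intro sum_bounded_above)
      finally show "card (A - U) \<le> \<eta> * card A" using cT by simp
    next
      fix t assume t: "t \<in> U"
      have "inj_on (\<lambda>s. inv s \<otimes> t) T"
      proof (rule inj_onI)
        fix s s' assume s: "s \<in> T" "s' \<in> T" "inv s \<otimes> t = inv s' \<otimes> t"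
        then have c: "s \<in> carrier G" "s' \<in> carrier G" "t \<in> carrier G" using T A t by (auto simp: U_def)
        with s have "inv s = inv s'" by simp
        then show "s = s'" using c by (metis inv_inv)
      qed
      moreover have "(\<lambda>s. inv s \<otimes> t) ` T \<subseteq> {g\<in>A. t \<in> W g}"
      proof
        fix g assume "g \<in> (\<lambda>s. inv s \<otimes> t) ` T"
        then obtain s where s: "s \<in> T" "g = inv s \<otimes> t" by blast
        then have "s \<in> carrier G" "t \<in> carrier G" using T A t by (auto simp: U_def)
        then have "s \<otimes> g = t" unfolding s(2) by (simp add: m_assoc[symmetric])
        with s t show "g \<in> {g\<in>A. t \<in> W g}" by (force simp: U_def W_def)
      qed
      ultimately show "card T \<le> card {g\<in>A. t \<in> W g}"
        using A by (intro card_inj_on_le) auto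
    next
      fix g assume "g \<in> A"
      show "finite (W g)" "card (W g) \<le> card T" using T by (auto simp: W_def card_image_le)
    next
      fix g x x' y
      assume *: "g \<in> A" "x \<in> E" "x' \<in> E" "y \<in> E" "near g x y" "near g x' y"
      \<comment> \<open>Where \<open>x\<close> and \<open>x'\<close> are \<open>L\<close> apart, the
        triangle inequality puts one of them at least \<open>L / 2\<close> away from the common
        centre \<open>y\<close>.\<close>
      let ?V = "far (L / 2) T (\<phi> g x) (\<phi> g y) \<union> far (L / 2) T (\<phi> g x') (\<phi> g y)"
      have finV: "finite ?V" using T by (auto simp: far_def)
      have "W g \<inter> far L A x x' \<subseteq> (\<lambda>t. t \<otimes> g) ` ?V"
      proof
        fix u assume u: "u \<in> W g \<inter> far L A x x'"
        then obtain t where t: "t \<in> T" "u = t \<otimes> g" by (auto simp: W_def)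
        have "\<phi> u z = \<phi> t (\<phi> g z)" if "z \<in> E" for z
          using t T A E * that by (auto intro: composition_rule)
        then have "L \<le> dist (\<phi> t (\<phi> g x)) (\<phi> t (\<phi> g x'))" using u * by (auto simp: far_def)
        also have "\<dots> \<le> dist (\<phi> t (\<phi> g x)) (\<phi> t (\<phi> g y)) + dist (\<phi> t (\<phi> g x')) (\<phi> t (\<phi> g y))"
          by (rule dist_triangle2)
        finally have "t \<in> ?V" using t by (auto simp: far_def)
        then show "u \<in> (\<lambda>t. t \<otimes> g) ` ?V" using t by blast
      qed
      then have "card (W g \<inter> far L A x x') \<le> card ((\<lambda>t. t \<otimes> g) ` ?V)"
        using finV by (intro card_mono) auto
      also have "\<dots> \<le> card ?V" using finV by (rule card_image_le)
      also have "\<dots> \<le> card (far (L / 2) T (\<phi> g x) (\<phi> g y)) + card (far (L / 2) T (\<phi> g x') (\<phi> g y))"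
        by (rule card_Un_le)
      finally show "card (W g \<inter> far L A x x') \<le> 2 * \<kappa> * card T"
        using *(5,6) unfolding near_def by linarith
    next
      show "far L A x x' \<subseteq> A" for x x' by (auto simp: far_def)
      show "card {g\<in>A. \<not> (\<exists>Y\<subseteq>E. card Y \<le> m \<and> card {x\<in>E. \<forall>y\<in>Y. \<not> near g x y} \<le> \<beta> * card E)} \<le> \<beta> * card A"
        using S_le by (simp add: S_def)
    qed (use sep pos const in auto)
    with large show False by simp
  qed
  define Ls where "Ls g = {xs. set xs \<subseteq> E \<and> length xs = Suc m \<and> sorted_wrt (\<lambda>x y. \<not> near g x y) xs}" for g
  have finLs: "finite (Ls g)" for g
    by (rule finite_subset[OF _ finite_lists_length_eq[OF E(1), of "Suc m"]]) (auto simp: Ls_def)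
  have Ls: "(\<beta> * card E) ^ Suc m \<le> card (Ls g)" if g: "g \<in> S" for g
    unfolding Ls_def
  proof (rule card_separated_lists[OF E(1)])
    fix Y assume "Y \<subseteq> E" "card Y \<le> m"
    with g have "\<not> card {x\<in>E. \<forall>y\<in>Y. \<not> near g x y} \<le> \<beta> * card E" unfolding S_def by blast
    then show "\<beta> * card E \<le> card {x\<in>E. \<forall>y\<in>Y. \<not> near g x y}" by simp
  qed (use pos in auto)
  let ?\<Omega> = "{xs. set xs \<subseteq> E \<and> length xs = Suc m} \<times> A"
  have fin\<Omega>: "finite ?\<Omega>" using E A finite_lists_length_eq by blast
  have card\<Omega>: "card ?\<Omega> = card E ^ Suc m * card A"
    using E by (simp add: card_cartesian_product card_lists_length_eq)
  have finS: "finite S" using A by (simp add: S_def)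
  have "card S * (\<beta> * card E) ^ Suc m \<le> (\<Sum>g\<in>S. real (card (Ls g)))"
    using sum_bounded_below[of S "(\<beta> * card E) ^ Suc m" "\<lambda>g. real (card (Ls g))"] Ls by blast
  also have "\<dots> = card (SIGMA g:S. Ls g)" using finS finLs by (simp add: card_SigmaI)
  also have "\<dots> = card (prod.swap ` (SIGMA g:S. Ls g))" by (simp add: card_image)
  also have "\<dots> \<le> card (?\<Omega> \<inter> spread_tuples \<kappa> (L / 2) m T)"
  proof -
    have "prod.swap ` (SIGMA g:S. Ls g) \<subseteq> ?\<Omega> \<inter> spread_tuples \<kappa> (L / 2) m T"
      using A E by (auto simp: S_def Ls_def spread_tuples_def near_def not_less)
    then show ?thesis using fin\<Omega> by (simp add: card_mono)
  qed
  finally have "card S * (\<beta> * card E) ^ Suc m \<le> card (?\<Omega> \<inter> spread_tuples \<kappa> (L / 2) m T)" .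
  moreover have "(\<beta> * card A) * (\<beta> * card E) ^ Suc m \<le> card S * (\<beta> * card E) ^ Suc m"
    using cardS pos by (intro mult_right_mono) auto
  moreover have "(\<beta> * card A) * (\<beta> * card E) ^ Suc m = \<beta> ^ (m + 2) * card ?\<Omega>"
    unfolding card\<Omega> by (simp add: power_mult_distrib)
  ultimately have "\<beta> ^ (m + 2) * card ?\<Omega> \<le> card (?\<Omega> \<inter> spread_tuples \<kappa> (L / 2) m T)" by linarith
  moreover have "0 < card ?\<Omega>" unfolding card\<Omega> using cE cA by simp
  ultimately show ?thesis unfolding freq_def by (simp add: pos_le_divide_eq)
qed

section \<open>Close pairs and the contradiction with mean equicontinuity\<close>

text \<open>Pigeonhole: two of the \<open>m + 1\<close> translated points share a ball. The pair is
  chosen from \<open>(xs, g)\<close> alone, so it is far apart on every window on which the tuple is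
  spread.\<close>

lemma ex_close_pair_spread:
  assumes mem: "(xs, g) \<in> spread_tuples \<kappa> L m T0" and Z: "finite Z" "card Z \<le> m"
    and cover: "X \<subseteq> (\<Union>z\<in>Z. ball z r)"
  obtains u v where "u \<in> X" "v \<in> X" "dist u v < 2 * r"
    "\<And>T. (xs, g) \<in> spread_tuples \<kappa> L m T \<Longrightarrow> \<kappa> * card T \<le> card (far L T u v)"
proof -
  have xs: "g \<in> carrier G" "set xs \<subseteq> X" "length xs = Suc m" using mem by (auto simp: spread_tuples_def)
  define zs where "zs = map (\<phi> g) xs"
  have zs: "zs ! i \<in> X" if "i \<le> m" for i
    using xs that by (auto simp: zs_def intro!: action_closed)
  then have "\<forall>i\<in>{..m}. \<exists>z. z \<in> Z \<and> dist z (zs ! i) < r" using cover by fastforce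
  from bchoice[OF this] obtain c where c: "\<And>i. i \<le> m \<Longrightarrow> c i \<in> Z \<and> dist (c i) (zs ! i) < r" by auto
  have "\<not> inj_on c {..m}"
    using card_inj_on_le[of c "{..m}" Z] Z c by auto
  then obtain a b where ab: "a < b" "b \<le> m" "c a = c b"
    unfolding inj_on_def by (metis atMost_iff linorder_neqE_nat)
  show ?thesis
  proof (rule that[of "zs ! a" "zs ! b"])
    show "zs ! a \<in> X" "zs ! b \<in> X" using zs ab by auto
    show "dist (zs ! a) (zs ! b) < 2 * r"
      using c[of a] c[of b] ab dist_triangle3[of "zs ! a" "zs ! b" "c a"] by auto
    fix T assume "(xs, g) \<in> spread_tuples \<kappa> L m T"
    then have "sorted_wrt (\<lambda>x y. \<kappa> * card T \<le> card (far L T (\<phi> g x) (\<phi> g y))) xs"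
      by (simp add: spread_tuples_def)
    from sorted_wrt_nth_less[OF this ab(1)] show "\<kappa> * card T \<le> card (far L T (zs ! a) (zs ! b))"
      using ab xs by (simp add: zs_def)
  qed
qed

text \<open>Each block is a closed condition on pairs, and any finitely many blocks are met by one
  close pair; compactness gives a pair meeting all of them. Its average over \<open>F n\<close> is
  large for infinitely many \<open>n\<close>, contrary to
  \<open>Dbar_less_imp_eventually_average_less\<close>.\<close>

lemma recurrent_spread_tuples_contradiction:
  fixes L \<kappa> :: real
  assumes F: "Folner_sequence G F" and k: "strict_mono (k :: nat \<Rightarrow> nat)" and pos: "0 < L" "0 < \<kappa>"
    and Z: "finite Z" "card Z \<le> m" "X \<subseteq> (\<Union>z\<in>Z. ball z (\<delta> / 4))"
    and \<delta>: "0 < \<delta>" "\<And>x y. x \<in> X \<Longrightarrow> y \<in> X \<Longrightarrow> dist x y < \<delta> \<Longrightarrow> Dbar G \<phi> x y < L * \<kappa> / 2"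
    and ne: "\<And>I. (\<Inter>i\<le>I. \<Union>j\<in>{k i..<k (Suc i)}. spread_tuples \<kappa> L m (F (j + J))) \<noteq> {}"
  shows False
proof -
  define f where "f j p = (\<Sum>t\<in>F j. dist (\<phi> t (fst p)) (\<phi> t (snd p)))" for j and p :: "'x \<times> 'x"
  have contf: "continuous_on (X \<times> X) (f j)" for j
  proof -
    have "continuous_on (X \<times> X) (\<lambda>p. \<phi> t (fst p))" "continuous_on (X \<times> X) (\<lambda>p. \<phi> t (snd p))" if "t \<in> F j" for t
      using that Folner_seqD(1)[OF F, of j]
      by (auto intro!: continuous_on_compose2[OF cont[of t]] continuous_intros)
    then show ?thesis unfolding f_def by (intro continuous_intros)
  qed
  have clX: "closed (X \<times> X)" using compact by (intro closed_Times compact_imp_closed)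
  define C where "C i = (\<Union>j\<in>{k i..<k (Suc i)}. {p \<in> X \<times> X. L * \<kappa> * card (F (j + J)) \<le> f (j + J) p})" for i
  \<comment> \<open>The pigeonhole pairs are less than \<delta>/2 apart; this closed bound survives
    the compactness argument and stays below \<delta>.\<close>
  define C0 where "C0 = {p \<in> X \<times> X. dist (fst p) (snd p) \<le> \<delta> / 2}"
  have C0: "compact C0"
  proof -
    have "closed C0" unfolding C0_def
      by (intro continuous_on_closed_Collect_le clX continuous_intros)
    moreover have "C0 = (X \<times> X) \<inter> C0" by (auto simp: C0_def)
    ultimately show ?thesis using compact_Int_closed compact_Times compact by metis
  qed
  have C: "closed (C i)" for i
    unfolding C_def
    by (intro closed_UN finite_atLeastLessThan ballI continuous_on_closed_Collect_le clX contf continuous_intros)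
  have "C0 \<inter> (\<Inter>i\<in>I'. C i) \<noteq> {}" if I': "finite I'" for I'
  proof -
    obtain I where I: "\<And>i. i \<in> I' \<Longrightarrow> i \<le> I"
      using finite_nat_set_iff_bounded_le[THEN iffD1, OF I'] by blast
    obtain xs g where w: "(xs, g) \<in> (\<Inter>i\<le>I. \<Union>j\<in>{k i..<k (Suc i)}. spread_tuples \<kappa> L m (F (j + J)))"
      using ne[of I] unfolding ex_in_conv[symmetric] split_paired_Ex by (elim exE)
    then obtain j0 where "(xs, g) \<in> spread_tuples \<kappa> L m (F (j0 + J))" by blast
    from ex_close_pair_spread[OF this Z] obtain u v where uv: "u \<in> X" "v \<in> X" "dist u v < 2 * (\<delta> / 4)"
      and spread: "\<And>T. (xs, g) \<in> spread_tuples \<kappa> L m T \<Longrightarrow> \<kappa> * card T \<le> card (far L T u v)" by blast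
    have "(u, v) \<in> C i" if i: "i \<in> I'" for i
    proof -
      obtain j where j: "j \<in> {k i..<k (Suc i)}" "(xs, g) \<in> spread_tuples \<kappa> L m (F (j + J))"
        using w I[OF i] by blast
      have fin: "finite (F (j + J))" using Folner_seqD[OF F] by blast
      have "L * \<kappa> * card (F (j + J)) \<le> L * card (far L (F (j + J)) u v)"
        using spread[OF j(2)] pos by simp
      also have "\<dots> \<le> (\<Sum>t\<in>far L (F (j + J)) u v. dist (\<phi> t u) (\<phi> t v))"
        using sum_bounded_below[of "far L (F (j + J)) u v" L "\<lambda>t. dist (\<phi> t u) (\<phi> t v)"]
        by (simp add: far_def mult.commute)
      also have "\<dots> \<le> f (j + J) (u, v)"
        unfolding f_def using fin by (auto intro!: sum_mono2 simp: far_def)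
      finally show ?thesis using j uv by (auto simp: C_def)
    qed
    then have "(u, v) \<in> C0 \<inter> (\<Inter>i\<in>I'. C i)" using uv by (auto simp: C0_def)
    then show ?thesis by blast
  qed
  then have "C0 \<inter> (\<Inter>i\<in>UNIV. C i) \<noteq> {}" by (rule compact_imp_fip_image[OF C0 C])
  then obtain u v where "(u, v) \<in> C0 \<inter> (\<Inter>i\<in>UNIV. C i)"
    unfolding ex_in_conv[symmetric] split_paired_Ex by (elim exE)
  then have uv: "(u, v) \<in> C0" "\<And>i. (u, v) \<in> C i" by simp_all
  have mem: "u \<in> X" "v \<in> X" "dist u v < \<delta>" using uv(1) \<delta>(1) by (auto simp: C0_def)
  \<comment> \<open>The half in \<open>L * \<kappa> / 2\<close> compensates the factor 2 lost
    between \<open>Dbar\<close> and the Folner averages.\<close>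
  have "\<forall>\<^sub>F n in sequentially. (\<Sum>t\<in>F n. dist (\<phi> t u) (\<phi> t v)) < 2 * (L * \<kappa> / 2) * card (F n)"
    using mem \<delta>(2) by (intro Dbar_less_imp_eventually_average_less[OF F])
  then obtain N where N: "\<And>n. N \<le> n \<Longrightarrow> f n (u, v) < L * \<kappa> * card (F n)"
    by (auto simp: eventually_sequentially f_def)
  obtain j where "j \<in> {k N..<k (Suc N)}" "L * \<kappa> * card (F (j + J)) \<le> f (j + J) (u, v)"
    using uv(2)[of N] by (auto simp: C_def)
  with N[of "j + J"] strict_mono_imp_increasing[OF k, of N] show False by auto
qed

section \<open>Choice of constants and vanishing of the entropy\<close>

text \<open>A genuine limit is established, since \<open>cover_entropy\<close> is defined by
  \<open>lim\<close>. Nonnegativity reduces it to an eventual upper bound, whose failure provides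
  the subsequence \<open>\<nu>\<close> on which the argument runs.\<close>

lemma average_log_cover_number_tendsto_0:
  assumes F: "Folner_sequence G F" and inf: "infinite (carrier G)"
    and eq: "Banach_mean_equicontinuous G X \<phi>" and U: "\<U> \<in> finite_open_covers X"
  shows "(\<lambda>n. (1 / real (card (F n))) *
    ln (real (cover_number X (cover_join (F n) (\<lambda>s. translate_cover G \<phi> s \<U>))))) \<longlonglongrightarrow> 0"
proof -
  define N where "N n = cover_number X (cover_join (F n) (\<lambda>s. translate_cover G \<phi> s \<U>))" for n
  define a where "a n = (1 / real (card (F n))) * ln (real (N n))" for n
  note Fn = Folner_seqD[OF F]
  \<comment> \<open>This covers \<open>N n = 0\<close>, as for empty \<open>X\<close>, by the
    convention \<open>ln 0 = 0\<close>.\<close>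
  have a0: "0 \<le> a n" for n by (cases "N n = 0") (auto simp: a_def)
  have upper: "\<forall>\<^sub>F n in sequentially. a n < h" if h: "0 < h" for h
  proof (rule ccontr)
    assume "\<not> ?thesis"
    then have "infinite {n. h \<le> a n}"
      by (simp add: INFM_iff_infinite[symmetric] frequently_def cofinite_eq_sequentially not_le)
    then obtain \<nu> :: "nat \<Rightarrow> nat" where \<nu>: "strict_mono \<nu>" "\<And>i. h \<le> a (\<nu> i)"
      using infinite_enumerate by blast
    have openU: "\<exists>B. open B \<and> A = X \<inter> B" if "A \<in> \<U>" for A
    proof -
      have "openin (top_of_set X) A" using U that by (simp add: finite_open_covers_def)
      then show ?thesis by (simp add: openin_open)
    qed
    then have "\<forall>A\<in>\<U>. \<exists>B. open B \<and> A = X \<inter> B" by blast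
    from bchoice[OF this] obtain B where B: "\<And>A. A \<in> \<U> \<Longrightarrow> open (B A)"
      "\<And>A. A \<in> \<U> \<Longrightarrow> A = X \<inter> B A" by blast
    have "\<Union>\<U> = X" using U by (simp add: finite_open_covers_def)
    then have "X \<subseteq> \<Union>(B ` \<U>)" using B by blast
    \<comment> \<open>A Lebesgue number, found for ambient open sets and then restricted to
      \<open>X\<close>; \<open>L\<close> is half of it because
      \<open>cover_number_le_separated\<close> needs the scale \<open>2 * L\<close>.\<close>
    from Heine_Borel_lemma[OF compact this] obtain e where e: "0 < e" "\<And>x. x \<in> X \<Longrightarrow> \<exists>V\<in>B ` \<U>. ball x e \<subseteq> V"
      using B(1) by blast
    define L where "L = e / 2"
    have L: "0 < L" "\<And>x. x \<in> X \<Longrightarrow> \<exists>A\<in>\<U>. \<forall>y\<in>X. dist x y < 2 * L \<longrightarrow> y \<in> A"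
    proof -
      show "0 < L" using e by (simp add: L_def)
      fix x assume "x \<in> X"
      from e(2)[OF this] obtain A where A: "A \<in> \<U>" "ball x e \<subseteq> B A" by blast
      show "\<exists>A\<in>\<U>. \<forall>y\<in>X. dist x y < 2 * L \<longrightarrow> y \<in> A"
      proof (intro bexI[of _ A] ballI impI)
        fix y assume "y \<in> X" "dist x y < 2 * L"
        then have "y \<in> X \<inter> B A" using A by (auto simp: L_def)
        then show "y \<in> A" using B(2)[OF A(1)] by blast
      qed (fact A)
    qed
    \<comment> \<open>First \<theta> and then \<epsilon> make each term of the Hamming count cost at
      most \<open>h / 8\<close>, so that \<open>E n\<close> keeps the exponential rate
      \<open>3 / 4 * h\<close> whenever \<open>h \<le> a n\<close>.\<close>
    define \<theta> where "\<theta> = min (1 / 2) (h / (8 * (card \<U> + 1)))"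
    have \<theta>: "0 < \<theta>" "\<theta> < 1" using h by (auto simp: \<theta>_def)
    have \<theta>U: "\<theta> * card \<U> \<le> h / 8"
    proof -
      have "\<theta> * card \<U> \<le> h / (8 * (card \<U> + 1)) * card \<U>"
        by (intro mult_right_mono) (auto simp: \<theta>_def)
      also have "\<dots> \<le> h / 8" using h by (simp add: field_simps)
      finally show ?thesis .
    qed
    define \<epsilon> where "\<epsilon> = h / (8 * ln (1 / \<theta>))"
    have ln\<theta>: "0 < ln (1 / \<theta>)" using \<theta> by (intro ln_gt_zero) (simp add: field_simps)
    have \<epsilon>: "0 < \<epsilon>" "\<epsilon> * ln (1 / \<theta>) = h / 8" using h ln\<theta> by (auto simp: \<epsilon>_def)
    define good where "good n E \<longleftrightarrow> finite E \<and> E \<subseteq> X \<and>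
        (\<forall>x\<in>E. \<forall>y\<in>E. x \<noteq> y \<longrightarrow> \<epsilon> * card (F n) < card (far L (F n) x y)) \<and>
        N n \<le> card E * exp (card (F n) * (\<epsilon> * ln (1 / \<theta>) + \<theta> * card \<U>))" for n E
    have "\<exists>E. good n E" for n
    proof -
      obtain E where "finite E" "E \<subseteq> X"
        "\<And>x y. x \<in> E \<Longrightarrow> y \<in> E \<Longrightarrow> x \<noteq> y \<Longrightarrow> \<epsilon> * card (F n) < card (far L (F n) x y)"
        "N n \<le> card E * exp (card (F n) * (\<epsilon> * ln (1 / \<theta>) + \<theta> * card \<U>))"
        by (rule cover_number_le_separated[OF Fn(2)[of n] Fn(3) Fn(1) U L \<theta> less_imp_le[OF \<epsilon>(1)]])
          (assumption, rule that, auto simp: N_def)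
      then show ?thesis unfolding good_def by (intro exI[of _ E] conjI ballI impI)
    qed
    then obtain E where "\<And>n. good n (E n)" by metis
    then have E: "\<And>n. finite (E n)" "\<And>n. E n \<subseteq> X"
      "\<And>n x y. x \<in> E n \<Longrightarrow> y \<in> E n \<Longrightarrow> x \<noteq> y \<Longrightarrow> \<epsilon> * card (F n) < card (far L (F n) x y)"
      "\<And>n. N n \<le> card (E n) * exp (card (F n) * (\<epsilon> * ln (1 / \<theta>) + \<theta> * card \<U>))"
      by (simp_all add: good_def)
    have cardE: "exp (3 / 4 * h * card (F n)) \<le> card (E n)" if "h \<le> a n" for n
    proof -
      have "h * card (F n) \<le> ln (N n)" using that Fn(4)[of n] by (simp add: a_def field_simps)
      moreover have "0 < h * card (F n)" using h Fn(4)[of n] by simp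
      ultimately have "exp (h * card (F n)) \<le> N n"
        by (metis exp_le_cancel_iff exp_ln ln_0 not_less of_nat_0 of_nat_0_less_iff order.strict_trans2 gr0I)
      also have "\<dots> \<le> card (E n) * exp (card (F n) * (\<epsilon> * ln (1 / \<theta>) + \<theta> * card \<U>))" by (rule E(4))
      also have "\<dots> \<le> card (E n) * exp (card (F n) * (h / 4))"
        using \<epsilon>(2) \<theta>U by (intro mult_left_mono iffD2[OF exp_le_cancel_iff]) auto
      finally have "exp (h * card (F n)) / exp (card (F n) * (h / 4)) \<le> card (E n)"
        by (simp add: pos_divide_le_eq)
      then show ?thesis by (simp add: exp_diff[symmetric] algebra_simps)
    qed
    \<comment> \<open>Each of the four terms of the error budget \<open>const\<close> is made at
      most \<open>\<epsilon> / 4\<close>.\<close>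
    define K where "K = max 1 (ln (12 / \<epsilon>))"
    define \<beta> where "\<beta> = \<epsilon> / (24 * (K + 1))"
    define \<kappa> where "\<kappa> = \<epsilon> / (8 * (K + 1))"
    have K: "0 < K" "ln (12 / \<epsilon>) \<le> K" by (auto simp: K_def)
    have pos: "0 < \<beta>" "0 < \<kappa>" using \<epsilon> K by (auto simp: \<beta>_def \<kappa>_def)
    have const: "\<epsilon> / 4 + 3 * exp (- K) + 6 * \<beta> * (K + 1) + 2 * \<kappa> * (K + 1) \<le> \<epsilon>"
    proof -
      have "exp (- K) \<le> exp (- ln (12 / \<epsilon>))" using K by simp
      also have "\<dots> = \<epsilon> / 12" using \<epsilon> by (simp add: exp_minus)
      finally have "3 * exp (- K) \<le> \<epsilon> / 4" by simp
      moreover have "6 * \<beta> * (K + 1) = \<epsilon> / 4" "2 * \<kappa> * (K + 1) = \<epsilon> / 4"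
        using K by (auto simp: \<beta>_def \<kappa>_def field_simps)
      ultimately show ?thesis by simp
    qed
    \<comment> \<open>The scale \<open>L / 2\<close> and the proportion \<kappa> are fixed before
      \<delta>, and \<open>m\<close> is read off from \<delta> only afterwards;
      \<open>\<beta> ^ (m + 2)\<close> may shrink with \<open>m\<close>, as it only has to be
      positive.\<close>
    have "0 < L / 2 * \<kappa> / 2" using L pos by simp
    then obtain \<delta> where \<delta>: "0 < \<delta>"
      "\<And>x y. x \<in> X \<Longrightarrow> y \<in> X \<Longrightarrow> dist x y < \<delta> \<Longrightarrow> Dbar G \<phi> x y < L / 2 * \<kappa> / 2"
      using eq unfolding Banach_mean_equicontinuous_def by blast
    obtain Z where Z: "finite Z" "X \<subseteq> (\<Union>z\<in>Z. ball z (\<delta> / 4))"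
      by (rule compactE_image[OF compact, of X "\<lambda>z. ball z (\<delta> / 4)"]) (use \<delta> in auto)
    define m where "m = card Z"
    have Fcard: "\<forall>\<^sub>F n in sequentially. c \<le> real (card (F n))" for c
      using Folner_card_at_top[OF F inf] by (simp add: filterlim_at_top)
    \<comment> \<open>On windows \<open>F j\<close> of this size the code length \<open>r\<close> is
      so short that \<open>(m + 1) ^ r\<close> has exponential rate at most
      \<open>h / 4\<close>.\<close>
    obtain J where J: "\<And>j. J \<le> j \<Longrightarrow> 4 * (K + 1) * ln (m + 1) / h \<le> card (F j)"
      using Fcard unfolding eventually_sequentially by blast
    define \<Omega> where "\<Omega> i = {xs. set xs \<subseteq> E (\<nu> i) \<and> length xs = Suc m} \<times> F (\<nu> i)" for i
    have fin\<Omega>: "finite (\<Omega> i)" for i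
      unfolding \<Omega>_def using finite_lists_length_eq[OF E(1)] Fn(2) by blast
    have "\<forall>\<^sub>F i in sequentially. \<beta> ^ (m + 2) \<le> freq (\<Omega> i) (spread_tuples \<kappa> (L / 2) m (F (j + J)))" for j
    proof -
      let ?T = "F (j + J)"
      \<comment> \<open>The bound \<open>4 * ln 2 / h + 1\<close> lets another rate
        \<open>h / 4\<close> absorb the factor 2 in front of the number of codes.\<close>
      have ev: "\<forall>\<^sub>F n in sequentially. max (card ?T) (4 * ln 2 / h + 1) \<le> real (card (F n)) \<and>
          (\<forall>s\<in>?T. card (sym_diff (s <#\<^bsub>G\<^esub> F n) (F n)) \<le> (\<epsilon> / 4) / card ?T * card (F n))"
        using \<epsilon> Fn by (intro eventually_conj Fcard eventually_sym_diff_le[OF F]) auto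
      show ?thesis
        using eventually_compose_filterlim[OF ev filterlim_subseq[OF \<nu>(1)]]
      proof eventually_elim
        case (elim i)
        let ?A = "F (\<nu> i)"
        have "2 * (m + 1) ^ nat \<lceil>K * card ?A / card ?T\<rceil> < card (E (\<nu> i))"
        proof -
          define r where "r = nat \<lceil>K * card ?A / card ?T\<rceil>"
          have cT: "0 < card ?T" and TA: "card ?T \<le> card ?A" using Fn(4) elim by auto
          have "r \<le> K * card ?A / card ?T + 1"
          proof -
            have "0 \<le> K * card ?A / card ?T" using K by simp
            then show ?thesis unfolding r_def by linarith
          qed
          also have "\<dots> \<le> (K + 1) * card ?A / card ?T" using cT TA by (simp add: field_simps)
          finally have "r * ln (m + 1) \<le> (K + 1) * card ?A / card ?T * ln (m + 1)"
            by (intro mult_right_mono) auto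
          also have "\<dots> = card ?A * ((K + 1) * ln (m + 1)) / card ?T" by simp
          also have "\<dots> \<le> card ?A * (h / 4 * card ?T) / card ?T"
            using J[of "j + J"] h by (intro divide_right_mono mult_left_mono) (auto simp: field_simps)
          also have "\<dots> = h / 4 * card ?A" using cT by simp
          finally have r: "r * ln (m + 1) \<le> h / 4 * card ?A" .
          have "4 * ln 2 / h < card ?A" using elim by simp
          then have "ln 2 < h / 4 * card ?A" using h by (simp add: field_simps)
          moreover have "0 < h * card ?A" using h Fn(4)[of "\<nu> i"] by simp
          ultimately have "ln 2 + r * ln (m + 1) < 3 / 4 * h * card ?A"
            using r by simp
          then have "exp (ln 2 + r * ln (m + 1)) < exp (3 / 4 * h * card ?A)" by simp
          also have "\<dots> \<le> card (E (\<nu> i))" by (rule cardE[OF \<nu>(2)])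
          also have "exp (ln 2 + r * ln (m + 1)) = real (2 * (m + 1) ^ r)"
            by (simp add: exp_add exp_of_nat_mult)
          finally show ?thesis unfolding r_def of_nat_less_iff .
        qed
        then show ?case
          unfolding \<Omega>_def using elim K pos
          by (intro freq_spread_tuples_ge[where \<epsilon> = \<epsilon> and \<eta> = "\<epsilon> / 4" and K = K, OF Fn(2,3,1) Fn(2,3,1) _ _ E(1,2,3) _ _ _ const])
            auto
      qed
    qed
    then obtain k where k: "strict_mono k"
      "\<And>I. (\<Inter>i\<le>I. \<Union>j\<in>{k i..<k (Suc i)}. spread_tuples \<kappa> (L / 2) m (F (j + J))) \<noteq> {}"
      using recurrent_blocks[of \<Omega> "\<beta> ^ (m + 2)" "\<lambda>j. spread_tuples \<kappa> (L / 2) m (F (j + J))"]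
        fin\<Omega> pos(1) by (auto simp del: power_Suc)
    show False
      by (rule recurrent_spread_tuples_contradiction[OF F k(1) _ pos(2) Z(1) _ Z(2) \<delta> k(2)])
        (use L in \<open>auto simp: m_def\<close>)
  qed
  have "a \<longlonglongrightarrow> 0"
  proof (rule order_tendstoI)
    fix c :: real assume "c < 0"
    then have "c < a n" for n using a0[of n] by linarith
    then show "\<forall>\<^sub>F n in sequentially. c < a n" by (intro always_eventually allI)
  qed (fact upper)
  then show ?thesis unfolding a_def[abs_def] N_def .
qed

end

theorem theorem1p2:
  fixes G :: "('g, 'b) monoid_scheme"
    and X :: "'x::metric_space set"
    and \<phi> :: "'g \<Rightarrow> 'x \<Rightarrow> 'x"
    and F :: "nat \<Rightarrow> 'g set"
  assumes "comm_group G"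
    and "countable (carrier G)" and "infinite (carrier G)"
    and "compact X"
    and "group_action G X \<phi>"
    and "\<And>g. g \<in> carrier G \<Longrightarrow> continuous_on X (\<phi> g)"
    and "Banach_mean_equicontinuous G X \<phi>"
    and "Folner_sequence G F"
  shows "top_entropy G X \<phi> F = 0"
proof -
  interpret compact_group_action G X \<phi>
    using assms(4-6) by (intro compact_group_action.intro compact_group_action_axioms.intro)
  have "cover_entropy G X \<phi> F \<U> = 0" if "\<U> \<in> finite_open_covers X" for \<U>
    unfolding cover_entropy_def
    by (intro limI average_log_cover_number_tendsto_0 assms that)
  then have "top_entropy G X \<phi> F = (SUP \<U>\<in>finite_open_covers X. 0)"
    unfolding top_entropy_def by (intro SUP_cong) simp_all
  \<comment> \<open>The supremum needs a nonempty index set: over no covers it would be minus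
    infinity.\<close>
  moreover have "{X} \<in> finite_open_covers X" by (simp add: finite_open_covers_def)
  ultimately show ?thesis by (metis SUP_const empty_iff)
qed

end
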